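(* Let $\mathbb{F}$ be a field of characteristic different from $2$. Let $V$ be an $n$-dimensional vector space over $\mathbb{F}$ equipped with a non-degenerate symmetric bilinear form $b$ with Witt index $\nu$, and let $\mathcal{V}$ be a nilpotent linear subspace of $\mathcal{A}_b$. Assume that $|\mathbb{F}| \geq \min(n,2\nu+1)$ and $\dim \mathcal{V}=\nu(n-\nu-1)$. Then $\mathcal{V}=\mathcal{NA}_{b,\mathcal{F}}$ for some maximal partially complete $b$-singular flag $\mathcal{F}$ of $V$.
   Context: An endomorphism $u$ of $V$ is $b$-alternating when the bilinear form $(x,y) \mapsto b(x,u(y))$ is alternating; $\mathcal{A}_b$ denotes the linear space of all $b$-alternating endomorphisms of $V$. A set of endomorphisms is nilpotent when all its elements are nilpotent. A linear subspace $X$ of $V$ is totally singular for $b$ if $b(x,y)=0$ for all $x,y \in X$; the Witt index of $b$ is the maximal dimension of a totally singular subspace. A flag $\mathcal{F}=(F_0,\dots,F_p)$ of $V$ is a finite increasing sequence of linear subspaces of $V$; it is partially complete if $\dim F_i=i$ for all $i\in\{0,\dots,p\}$; it is $b$-singular if $F_p$ is totally singular for $b$; a partially complete $b$-singular flag is maximal if $p$ equals the Witt index of $b$. An endomorphism $u$ stabilizes $\mathcal{F}$ if $u(F_i)\subset F_i$ for all $i$. For a maximal partially complete $b$-singular flag $\mathcal{F}$, $\mathcal{NA}_{b,\mathcal{F}}$ denotes the set of all nilpotent $u \in \mathcal{A}_b$ that stabilize $\mathcal{F}$. *)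

theory Defs
  imports Complex_Main "HOL-Library.Function_Algebras"
begin

text \<open>
  The vector space \<open>V\<close> is a whole type \<open>'b\<close> with scalar multiplication \<open>scale\<close>. Endomorphisms are
  functions \<open>'b \<Rightarrow> 'b\<close>, added pointwise and scaled by \<open>fun_scale scale\<close>, so that the library's
  \<open>subspace\<close> and \<open>dim\<close> apply to sets of endomorphisms.
\<close>

definition fun_scale :: "('a \<Rightarrow> 'b \<Rightarrow> 'b) \<Rightarrow> 'a \<Rightarrow> ('c \<Rightarrow> 'b) \<Rightarrow> 'c \<Rightarrow> 'b" where
  "fun_scale scale c u = (\<lambda>x. scale c (u x))"

lemma vector_space_fun_scale:
  assumes "vector_space scale"
  shows "vector_space (fun_scale scale)"
proof -
  interpret vector_space scale by fact
  show ?thesis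
    by unfold_locales
      (auto simp: fun_scale_def fun_eq_iff scale_right_distrib scale_left_distrib)
qed

definition bilinear_form ::
  "('a::field \<Rightarrow> 'b::ab_group_add \<Rightarrow> 'b) \<Rightarrow> ('b \<Rightarrow> 'b \<Rightarrow> 'a) \<Rightarrow> bool" where
  "bilinear_form scale b \<longleftrightarrow>
     (\<forall>x. Vector_Spaces.linear scale (*) (\<lambda>y. b x y)) \<and>
     (\<forall>y. Vector_Spaces.linear scale (*) (\<lambda>x. b x y))"

definition symmetric_form :: "('b \<Rightarrow> 'b \<Rightarrow> 'a) \<Rightarrow> bool" where
  "symmetric_form b \<longleftrightarrow> (\<forall>x y. b x y = b y x)"

text \<open>One-sided non-degeneracy suffices, since it is only used for symmetric forms.\<close>

definition nondegenerate_form :: "('b::zero \<Rightarrow> 'b \<Rightarrow> 'a::zero) \<Rightarrow> bool" where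
  "nondegenerate_form b \<longleftrightarrow> (\<forall>x. (\<forall>y. b x y = 0) \<longrightarrow> x = 0)"

definition alternating_form ::
  "('a::field \<Rightarrow> 'b::ab_group_add \<Rightarrow> 'b) \<Rightarrow> ('b \<Rightarrow> 'b \<Rightarrow> 'a) \<Rightarrow> bool" where
  "alternating_form scale c \<longleftrightarrow> bilinear_form scale c \<and> (\<forall>x. c x x = 0)"

definition alternating_endos ::
  "('a::field \<Rightarrow> 'b::ab_group_add \<Rightarrow> 'b) \<Rightarrow> ('b \<Rightarrow> 'b \<Rightarrow> 'a) \<Rightarrow> ('b \<Rightarrow> 'b) set" where
  "alternating_endos scale b =
     {u. Vector_Spaces.linear scale scale u \<and> alternating_form scale (\<lambda>x y. b x (u y))}"

text \<open>The power is iterated composition \<open>^^\<close>; \<open>^\<close> would be the pointwise power.\<close>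

definition nilpotent_endo :: "('b::zero \<Rightarrow> 'b) \<Rightarrow> bool" where
  "nilpotent_endo u \<longleftrightarrow> (\<exists>k. u ^^ k = (\<lambda>x. 0))"

definition totally_singular ::
  "('a::field \<Rightarrow> 'b::ab_group_add \<Rightarrow> 'b) \<Rightarrow> ('b \<Rightarrow> 'b \<Rightarrow> 'a) \<Rightarrow> 'b set \<Rightarrow> bool" where
  "totally_singular scale b X \<longleftrightarrow>
     module.subspace scale X \<and> (\<forall>x\<in>X. \<forall>y\<in>X. b x y = 0)"

text \<open>In finite dimension the set of dimensions below is finite and contains \<open>0\<close>.\<close>

definition witt_index ::
  "('a::field \<Rightarrow> 'b::ab_group_add \<Rightarrow> 'b) \<Rightarrow> ('b \<Rightarrow> 'b \<Rightarrow> 'a) \<Rightarrow> nat" where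
  "witt_index scale b = Max (vector_space.dim scale ` {X. totally_singular scale b X})"

text \<open>A flag \<open>(F\<^sub>0, \<dots>, F\<^sub>p)\<close> is the nonempty list \<open>[F\<^sub>0, \<dots>, F\<^sub>p]\<close>, of length \<open>p + 1\<close>.\<close>

definition flag ::
  "('a::field \<Rightarrow> 'b::ab_group_add \<Rightarrow> 'b) \<Rightarrow> 'b set list \<Rightarrow> bool" where
  "flag scale Fs \<longleftrightarrow>
     Fs \<noteq> [] \<and> (\<forall>F\<in>set Fs. module.subspace scale F) \<and> sorted_wrt (\<subseteq>) Fs"

definition partially_complete ::
  "('a::field \<Rightarrow> 'b::ab_group_add \<Rightarrow> 'b) \<Rightarrow> 'b set list \<Rightarrow> bool" where
  "partially_complete scale Fs \<longleftrightarrow> (\<forall>i<length Fs. vector_space.dim scale (Fs ! i) = i)"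

definition singular_flag ::
  "('a::field \<Rightarrow> 'b::ab_group_add \<Rightarrow> 'b) \<Rightarrow> ('b \<Rightarrow> 'b \<Rightarrow> 'a) \<Rightarrow> 'b set list \<Rightarrow> bool" where
  "singular_flag scale b Fs \<longleftrightarrow> totally_singular scale b (last Fs)"

definition maximal_pc_singular_flag ::
  "('a::field \<Rightarrow> 'b::ab_group_add \<Rightarrow> 'b) \<Rightarrow> ('b \<Rightarrow> 'b \<Rightarrow> 'a) \<Rightarrow> 'b set list \<Rightarrow> bool" where
  "maximal_pc_singular_flag scale b Fs \<longleftrightarrow>
     flag scale Fs \<and> partially_complete scale Fs \<and> singular_flag scale b Fs \<and>
     length Fs = witt_index scale b + 1"

definition stabilizes_flag :: "('b \<Rightarrow> 'b) \<Rightarrow> 'b set list \<Rightarrow> bool" where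
  "stabilizes_flag u Fs \<longleftrightarrow> (\<forall>F\<in>set Fs. u ` F \<subseteq> F)"

definition NA ::
  "('a::field \<Rightarrow> 'b::ab_group_add \<Rightarrow> 'b) \<Rightarrow> ('b \<Rightarrow> 'b \<Rightarrow> 'a) \<Rightarrow> 'b set list \<Rightarrow> ('b \<Rightarrow> 'b) set" where
  "NA scale b Fs = {u \<in> alternating_endos scale b. nilpotent_endo u \<and> stabilizes_flag u Fs}"

end

theory Submission
  imports Defs
begin

text \<open>
  Let \<open>V\<close> be a nilpotent space of alternating endomorphisms of a regular space \<open>W\<close> of dimension \<open>n\<close>
  and Witt index \<open>\<nu>\<close>, let \<open>x\<close> be a nonzero isotropic vector and write
  \<open>x \<and> w = (z \<mapsto> b w z *s x - b x z *s w)\<close>. The elements of \<open>V\<close> that kill \<open>x\<close> act on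
  \<open>x\<^sup>\<bottom> / x\<close>, realised as the orthogonal complement of a hyperbolic pair through \<open>x\<close>. The trace
  form vanishes on \<open>V\<close>, so an element \<open>x \<and> w\<close> of \<open>V\<close> has \<open>w\<close> orthogonal to \<open>x\<close> and \<open>V x\<close>; this gives
  \<open>dim V \<le> n - 2 + dim V'\<close> for the induced space \<open>V'\<close>, hence \<open>dim V \<le> \<nu> (n - \<nu> - 1)\<close>. If equality holds,
  then for every isotropic \<open>x\<close> the space \<open>V'\<close> is again of maximal dimension and \<open>V\<close> contains
  all \<open>x \<and> w\<close> with \<open>w\<close> orthogonal to \<open>x\<close> and \<open>V x\<close>. It follows that \<open>V\<close> contains every nilpotent alternating
  endomorphism that is trace-orthogonal to it, in particular the cubes of its elements.

  The heart of the matter is that \<open>V\<close> kills some nonzero isotropic \<open>x\<close>. Take \<open>x\<close> with \<open>dim (V x)\<close>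
  minimal and suppose \<open>V x \<noteq> 0\<close>. Closure under cubes makes \<open>Fx + V x\<close> stable under the stabilizer of
  \<open>x\<close>, and induction applied to \<open>V'\<close> yields an isotropic \<open>y = u x\<close> in \<open>V x\<close> that the
  stabilizer maps into \<open>Fx\<close>. By minimality \<open>e = u y\<close> is not in \<open>Fx + V x\<close>; then some
  \<open>x \<and> w\<close> in \<open>V\<close> has \<open>b w e = 1\<close> and \<open>(u + x \<and> w)^3 x = u^3 x + x\<close>, so that \<open>x\<close> lies in \<open>V x\<close>,
  contradicting nilpotency. The flag is obtained by iterating \<open>x\<close>.
\<close>

section \<open>Dimension counts inside a finitely spanned set\<close>

text \<open>Endomorphisms live in the space of all functions \<open>'b \<Rightarrow> 'b\<close>,
  which may be infinite-dimensional. Finiteness therefore enters only through a finite set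
  \<open>R\<close> whose span contains \<open>V\<close>.\<close>

lemma (in vector_space) subspace_dim_psubset:
  assumes "subspace U" "subspace V" "U \<subset> V" "finite R" "V \<subseteq> span R"
  shows "dim U < dim V"
proof -
  obtain B where B: "B \<subseteq> U" "independent B" "U \<subseteq> span B" "card B = dim U"
    using basis_exists by blast
  obtain x where x: "x \<in> V" "x \<notin> U" using assms(3) by blast
  have sB: "span B = U" using B assms(1) span_subspace by blast
  then have ind: "independent (insert x B)" using x B(2) independent_insertI by blast
  obtain C where C: "insert x B \<subseteq> C" "C \<subseteq> V" "independent C" "V \<subseteq> span C"
    using maximal_independent_subset_extend[OF _ ind, of V] x(1) B(1) assms(3) by blast
  have finC: "finite C"
    using independent_span_bound[OF assms(4) C(3)] C(2) assms(5) by blast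
  have "x \<notin> B" using x(2) B(1) by blast
  then have "card B < card (insert x B)"
    using finite_subset[OF C(1) finC] by simp
  also have "\<dots> \<le> card C" using C(1) finC by (rule card_mono[rotated])
  also have "card C = dim V" using C by (simp add: basis_card_eq_dim)
  finally show ?thesis using B(4) by simp
qed

text \<open>A basis \<open>A\<close> of the kernel in \<open>V\<close> extends to a basis
  \<open>B\<close> of \<open>V\<close>; \<open>f\<close> is injective on the span of
  \<open>B - A\<close> and carries it onto the image of \<open>V\<close>.\<close>

lemma rank_nullity:
  assumes lin: "Vector_Spaces.linear s1 s2 f"
    and V: "module.subspace s1 V" and R: "finite R" "V \<subseteq> module.span s1 R"
  shows "vector_space.dim s1 V =
    vector_space.dim s2 (f ` V) + vector_space.dim s1 {v \<in> V. f v = 0}"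
proof -
  interpret f: Vector_Spaces.linear s1 s2 f by fact
  let ?K = "{v \<in> V. f v = 0}"
  have K: "f.vs1.subspace ?K"
    using f.vs1.subspace_inter[OF V f.subspace_kernel] by (metis Collect_conj_eq Collect_mem_eq)
  obtain A where A: "A \<subseteq> ?K" "f.vs1.independent A" "?K \<subseteq> f.vs1.span A" "card A = f.vs1.dim ?K"
    using f.vs1.basis_exists by blast
  have sA: "f.vs1.span A = ?K" using A K f.vs1.span_subspace by blast
  obtain B where B: "A \<subseteq> B" "B \<subseteq> V" "f.vs1.independent B" "V \<subseteq> f.vs1.span B"
    using f.vs1.maximal_independent_subset_extend[OF _ A(2), of V] A(1) by blast
  have sB: "f.vs1.span B = V" using B V f.vs1.span_subspace by blast
  have finB: "finite B"
    using f.vs1.independent_span_bound[OF R(1) B(3)] B(2) R(2) by blast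
  have indBA: "f.vs1.independent (B - A)"
    using B(3) f.vs1.independent_mono by blast
  have inj: "inj_on f (f.vs1.span (B - A))"
  proof (subst f.inj_on_iff_eq_0[OF f.vs1.subspace_span], intro ballI impI)
    fix x assume x: "x \<in> f.vs1.span (B - A)" "f x = 0"
    then have "x \<in> V" using sB f.vs1.span_mono[of "B - A" B] by blast
    then have xA: "x \<in> f.vs1.span A" using x(2) sA by blast
    \<comment> \<open>A nonzero coefficient of \<open>x\<close> would have to sit at an element of
      both \<open>B - A\<close> and \<open>A\<close>.\<close>
    have "f.vs1.representation B x = f.vs1.representation (B - A) x"
      by (rule f.vs1.representation_extend[OF B(3) x(1)]) blast
    moreover have "f.vs1.representation B x = f.vs1.representation A x"
      by (rule f.vs1.representation_extend[OF B(3) xA B(1)])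
    ultimately have "f.vs1.representation B x v = 0" for v
      by (metis (no_types, lifting) DiffD2 f.vs1.representation_ne_zero)
    then show "x = 0"
      using f.vs1.sum_representation_eq[OF B(3) _ finB, of x] \<open>x \<in> V\<close> B(4) by auto
  qed
  have im: "f.vs2.span (f ` (B - A)) = f ` V"
  proof -
    have "f ` B \<subseteq> insert 0 (f ` (B - A))" using A(1) by auto
    then have "f.vs2.span (f ` B) \<subseteq> f.vs2.span (f ` (B - A))"
      using f.vs2.span_mono f.vs2.span_insert_0 by metis
    moreover have "f.vs2.span (f ` (B - A)) \<subseteq> f.vs2.span (f ` B)"
      by (rule f.vs2.span_mono) blast
    ultimately show ?thesis using f.span_image[of B] sB by auto
  qed
  have "f.vs2.dim (f ` V) = card (f ` (B - A))"
    using f.vs2.dim_span_eq_card_independent[OF f.independent_injective_image[OF indBA inj]] im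
    by simp
  also have "\<dots> = card (B - A)"
    by (rule card_image, rule inj_on_subset[OF inj]) (use f.vs1.span_base in blast)
  also have "\<dots> = card B - card A" using B(1) finB by (simp add: card_Diff_subset finite_subset)
  finally have "f.vs2.dim (f ` V) = card B - card A" .
  moreover have "card A \<le> card B" using B(1) finB by (rule card_mono[rotated])
  moreover have "card B = f.vs1.dim V"
    using B f.vs1.basis_card_eq_dim by blast
  ultimately show ?thesis using A(4) by simp
qed

section \<open>Trace of an endomorphism\<close>

lemma linear_simps:
  assumes "Vector_Spaces.linear s1 s2 f"
  shows linear_add: "f (x + y) = f x + f y"
    and linear_diff: "f (x - y) = f x - f y"
    and linear_minus: "f (- x) = - f x"
    and linear_zero: "f 0 = 0"
    and linear_scale: "f (s1 c x) = s2 c (f x)"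
proof -
  interpret f: Vector_Spaces.linear s1 s2 f by fact
  show "f (x + y) = f x + f y" "f (x - y) = f x - f y" "f (- x) = - f x" "f 0 = 0"
    "f (s1 c x) = s2 c (f x)"
    by (fact f.add f.diff f.neg f.zero f.scale)+
qed

lemma nilpotent_endo_iff: "nilpotent_endo u \<longleftrightarrow> (\<exists>k. \<forall>x. (u ^^ k) x = 0)"
  by (auto simp: nilpotent_endo_def fun_eq_iff)

context finite_dimensional_vector_space
begin

abbreviation lin :: "('b \<Rightarrow> 'b) \<Rightarrow> bool" where
  "lin \<equiv> Vector_Spaces.linear scale scale"

lemma linI:
  assumes "\<And>x y. u (x + y) = u x + u y" "\<And>c x. u (c *s x) = c *s u x"
  shows "lin u"
  using assms vector_space_axioms by (simp add: Vector_Spaces.linear_iff)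

lemma linear_funpow_0: "lin u \<Longrightarrow> (u ^^ k) 0 = 0"
  by (induction k) (simp_all add: linear_zero)

lemma nilpotent_endo_funpow:
  assumes "lin u" "nilpotent_endo u" "k > 0"
  shows "nilpotent_endo (u ^^ k)"
proof -
  obtain m where m: "\<And>x. (u ^^ m) x = 0"
    using assms(2) by (auto simp: nilpotent_endo_iff)
  have "((u ^^ k) ^^ m) x = 0" for x
  proof -
    have "k * m = (k * m - m) + m" using assms(3) by simp
    then have "((u ^^ k) ^^ m) x = (u ^^ (k * m - m)) ((u ^^ m) x)"
      by (metis funpow_add funpow_mult o_apply)
    then show ?thesis using m linear_funpow_0[OF assms(1)] by simp
  qed
  then show ?thesis by (auto simp: nilpotent_endo_iff)
qed

lemma nilpotent_endo_eigen:
  assumes "nilpotent_endo u" "lin u" "u x = c *s x" "c \<noteq> 0"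
  shows "x = 0"
proof -
  obtain k where k: "(u ^^ k) x = 0"
    using assms(1) by (auto simp: nilpotent_endo_iff)
  have "(u ^^ k) x = c ^ k *s x"
    by (induction k) (simp_all add: linear_scale[OF assms(2)] assms(3) mult.commute)
  then show ?thesis using k assms(4) by simp
qed

definition trace :: "('b \<Rightarrow> 'b) \<Rightarrow> 'a" where
  "trace u = (\<Sum>e\<in>Basis. representation Basis (u e) e)"

lemma in_span_Basis: "x \<in> span Basis"
  by (simp add: span_Basis)

lemma sum_representation_Basis: "(\<Sum>e\<in>Basis. representation Basis x e *s e) = x"
  using sum_representation_eq[OF independent_Basis in_span_Basis finite_Basis, of x] by simp

lemma trace_add: "trace (\<lambda>x. u x + v x) = trace u + trace v"
  by (simp add: trace_def representation_add[OF independent_Basis in_span_Basis in_span_Basis]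
      sum.distrib)

lemma trace_scale: "trace (\<lambda>x. c *s u x) = c * trace u"
  by (simp add: trace_def representation_scale[OF independent_Basis in_span_Basis]
      sum_distrib_left)

lemma trace_zero: "trace (\<lambda>x. 0) = 0"
  by (simp add: trace_def representation_zero)

lemma trace_minus: "trace (\<lambda>x. - u x) = - trace u"
  using trace_scale[of "-1" u] by simp

lemma trace_diff: "trace (\<lambda>x. u x - v x) = trace u - trace v"
  using trace_add[of u "\<lambda>x. - v x"] by (simp add: trace_minus)

lemma trace_sum: "finite I \<Longrightarrow> trace (\<lambda>x. \<Sum>i\<in>I. u i x) = (\<Sum>i\<in>I. trace (u i))"
  by (induction I rule: finite_induct) (simp_all add: trace_zero trace_add)

lemma trace_rank_one:
  assumes "Vector_Spaces.linear scale (*) \<phi>"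
  shows "trace (\<lambda>x. \<phi> x *s a) = \<phi> a"
proof -
  interpret f: Vector_Spaces.linear scale "(*)" \<phi> by fact
  have "trace (\<lambda>x. \<phi> x *s a) = (\<Sum>e\<in>Basis. \<phi> (representation Basis a e *s e))"
    by (simp add: trace_def representation_scale[OF independent_Basis in_span_Basis]
        f.scale mult.commute)
  also have "\<dots> = \<phi> a" by (simp only: f.sum[symmetric] sum_representation_Basis)
  finally show ?thesis .
qed

lemma trace_commute:
  assumes u: "lin u" and v: "lin v"
  shows "trace (\<lambda>x. u (v x)) = trace (\<lambda>x. v (u x))"
proof -
  interpret v: Vector_Spaces.linear scale scale v by fact
  interpret u: Vector_Spaces.linear scale scale u by fact
  let ?r = "representation Basis"
  have "v (u x) = (\<Sum>e\<in>Basis. ?r (u x) e *s v e)" for x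
  proof -
    have "v (u x) = v (\<Sum>e\<in>Basis. ?r (u x) e *s e)" by (simp add: sum_representation_Basis)
    then show ?thesis by (simp add: v.sum v.scale)
  qed
  then have "trace (\<lambda>x. v (u x)) = (\<Sum>e\<in>Basis. trace (\<lambda>x. ?r (u x) e *s v e))"
    by (simp add: trace_sum finite_Basis)
  also have "\<dots> = (\<Sum>e\<in>Basis. ?r (u (v e)) e)"
  proof (rule sum.cong[OF refl], rule trace_rank_one)
    fix e
    interpret vs: vector_space "(*) :: 'a \<Rightarrow> 'a \<Rightarrow> 'a"
      by unfold_locales (auto simp: algebra_simps)
    show "Vector_Spaces.linear scale (*) (\<lambda>x. ?r (u x) e)"
      by unfold_locales
        (simp_all add: u.add u.scale representation_add[OF independent_Basis in_span_Basis in_span_Basis]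
          representation_scale[OF independent_Basis in_span_Basis])
  qed
  finally show ?thesis by (simp add: trace_def)
qed

text \<open>Composing with a projection onto the range lowers the nilpotency index without changing
  the trace.\<close>

lemma trace_nilpotent:
  assumes "lin u" "nilpotent_endo u"
  shows "trace u = 0"
proof -
  obtain k where "\<forall>x. (u ^^ k) x = 0" using assms(2) by (auto simp: nilpotent_endo_iff)
  then show ?thesis using assms(1)
  proof (induction k arbitrary: u)
    case 0
    then have "x = 0" for x :: 'b by simp
    then have "u = (\<lambda>x. 0)" by (metis ext)
    then show ?case by (simp add: trace_zero)
  next
    case (Suc k)
    show ?case
    \<comment> \<open>The power formula \<open>pw\<close> below needs a positive exponent, so index
      at most one is treated apart.\<close>
    proof (cases "k = 0")
      case True
      then have "u = (\<lambda>x. 0)" using Suc.prems(1) by auto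
      then show ?thesis by (simp add: trace_zero)
    next
      case False
      interpret p: vector_space_pair scale scale ..
      obtain g where g: "lin g" "\<And>y. u (g (u y)) = u y"
        using p.linear_exists_right_inverse_on[OF Suc.prems(2) subspace_UNIV] by auto
      let ?w = "\<lambda>x. u (u (g x))"
      have w: "lin ?w"
        by (rule linI) (simp_all add: linear_simps[OF Suc.prems(2)] linear_simps[OF g(1)])
      have pw: "(?w ^^ m) x = (u ^^ m) (u (g x))" if "m > 0" for m x
        using that
      proof (induction m)
        case (Suc m)
        show ?case
        proof (cases m)
          case m: (Suc l)
          then have "(?w ^^ m) x = u ((u ^^ l) (u (g x)))" using Suc.IH by simp
          then show ?thesis using m g(2) by simp
        qed simp
      qed simp
      have "(?w ^^ k) x = 0" for x
        using pw[of k x] Suc.prems(1) False by (simp add: funpow_swap1[of u])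
      then have "trace ?w = 0" using Suc.IH w by blast
      moreover have "trace ?w = trace (\<lambda>x. u (g (u x)))"
      proof (rule trace_commute)
        show "lin u" by fact
        show "lin (\<lambda>x. u (g x))"
          by (rule linI) (simp_all add: linear_simps[OF Suc.prems(2)] linear_simps[OF g(1)])
      qed
      ultimately show ?thesis by (simp add: g(2))
    qed
  qed
qed

end

section \<open>Alternating endomorphisms of a quadratic space\<close>

locale quadratic_space = finite_dimensional_vector_space scale Basis
  for scale :: "'a::field \<Rightarrow> 'b::ab_group_add \<Rightarrow> 'b" (infixr \<open>*s\<close> 75)
    and Basis :: "'b set" +
  fixes b :: "'b \<Rightarrow> 'b \<Rightarrow> 'a"
  assumes bilinear: "bilinear_form scale b"
    and b_sym: "b x y = b y x"
    and two_neq_0: "(2::'a) \<noteq> 0"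
begin

sublocale fs: vector_space "fun_scale scale :: 'a \<Rightarrow> ('b \<Rightarrow> 'b) \<Rightarrow> 'b \<Rightarrow> 'b"
  by (rule vector_space_fun_scale) (fact vector_space_axioms)

lemma linear_b_right: "Vector_Spaces.linear scale (*) (b x)"
  using bilinear by (simp add: bilinear_form_def)

lemma linear_b_left: "Vector_Spaces.linear scale (*) (\<lambda>x. b x y)"
  using bilinear by (simp add: bilinear_form_def)

lemma b_simps [simp]:
  "b (x + y) z = b x z + b y z" "b x (y + z) = b x y + b x z"
  "b (x - y) z = b x z - b y z" "b x (y - z) = b x y - b x z"
  "b (- x) z = - b x z" "b x (- z) = - b x z"
  "b 0 z = 0" "b x 0 = 0"
  "b (c *s x) z = c * b x z" "b x (c *s z) = c * b x z"
  using linear_simps[OF linear_b_right] linear_simps[OF linear_b_left] by auto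

definition perp :: "'b set \<Rightarrow> 'b set" where
  "perp S = {z. \<forall>s\<in>S. b s z = 0}"

text \<open>The induction passes to smaller quadratic spaces without changing the type: each is a
  subspace \<open>W\<close> on which \<open>b\<close> is nondegenerate, while \<open>b\<close> may
  degenerate on the whole type.\<close>

definition regular :: "'b set \<Rightarrow> bool" where
  "regular W \<longleftrightarrow> subspace W \<and> (\<forall>x\<in>W. (\<forall>y\<in>W. b x y = 0) \<longrightarrow> x = 0)"

lemma subspace_perp: "subspace (perp S)"
  by (rule subspaceI) (auto simp: perp_def)

lemma subspace_inter_perp: "subspace W \<Longrightarrow> subspace (W \<inter> perp S)"
  using subspace_perp subspace_inter by blast

lemma dim_le_dim_kernel_functional:
  assumes "subspace S" "Vector_Spaces.linear scale (*) \<phi>"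
  shows "dim S \<le> dim {z \<in> S. \<phi> z = 0} + 1"
proof -
  interpret vs: vector_space "(*) :: 'a \<Rightarrow> 'a \<Rightarrow> 'a"
    by unfold_locales (auto simp: algebra_simps)
  have "\<phi> ` S \<subseteq> vs.span {1}" by (auto simp: vs.span_singleton)
  then have "vs.dim (\<phi> ` S) \<le> 1" using vs.dim_le_card[of "\<phi> ` S" "{1}"] by simp
  moreover have "dim S = vs.dim (\<phi> ` S) + dim {z \<in> S. \<phi> z = 0}"
    by (rule rank_nullity[OF assms(2,1) finite_Basis]) (simp add: span_Basis)
  ultimately show ?thesis by simp
qed

lemma dim_le_dim_perp:
  assumes "finite C" "subspace S"
  shows "dim S \<le> dim (S \<inter> perp C) + card C"
  using assms(1)
proof (induction C rule: finite_induct)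
  case empty
  then show ?case by (simp add: perp_def)
next
  case (insert c C)
  have "dim (S \<inter> perp C) \<le> dim {z \<in> S \<inter> perp C. b c z = 0} + 1"
    by (rule dim_le_dim_kernel_functional[OF subspace_inter_perp[OF assms(2)] linear_b_right])
  also have "{z \<in> S \<inter> perp C. b c z = 0} = S \<inter> perp (insert c C)"
    by (auto simp: perp_def)
  finally show ?case using insert by simp
qed

lemma perp_span: "perp (span C) = perp C"
proof
  show "perp (span C) \<subseteq> perp C" using span_base by (auto simp: perp_def)
  show "perp C \<subseteq> perp (span C)"
  proof
    fix z assume "z \<in> perp C"
    then have "C \<subseteq> {s. b s z = 0}" by (auto simp: perp_def)
    then have "span C \<subseteq> {s. b s z = 0}"
      by (rule span_minimal) (auto intro: subspaceI)
    then show "z \<in> perp (span C)" by (auto simp: perp_def)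
  qed
qed

text \<open>One inequality counts the equations given by a basis of \<open>S\<close>. For the other,
  a basis \<open>A\<close> of the complement is extended to a basis \<open>C\<close> of
  \<open>W\<close>: an element of \<open>S\<close> orthogonal to \<open>C - A\<close> is orthogonal
  to all of \<open>W\<close>, hence zero.\<close>

lemma dim_perp:
  assumes W: "regular W" and S: "subspace S" "S \<subseteq> W"
  shows "dim (W \<inter> perp S) + dim S = dim W"
proof -
  have sW: "subspace W" using W by (simp add: regular_def)
  let ?K = "W \<inter> perp S"
  have sK: "subspace ?K" using sW by (rule subspace_inter_perp)
  obtain B where B: "B \<subseteq> S" "independent B" "S \<subseteq> span B" "card B = dim S"
    using basis_exists by blast
  have "finite B" using B(2) by (rule finiteI_independent)
  then have "dim W \<le> dim (W \<inter> perp B) + card B" using sW by (rule dim_le_dim_perp)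
  moreover have "span B = S" using B S span_subspace by blast
  ultimately have ge: "dim W \<le> dim ?K + dim S" using B(4) by (metis perp_span)
  obtain A where A: "A \<subseteq> ?K" "independent A" "?K \<subseteq> span A" "card A = dim ?K"
    using basis_exists by blast
  obtain C where C: "A \<subseteq> C" "C \<subseteq> W" "independent C" "W \<subseteq> span C"
    using maximal_independent_subset_extend[OF _ A(2), of W] A(1) by blast
  have finC: "finite C" using C(3) by (rule finiteI_independent)
  have "S \<inter> perp (C - A) \<subseteq> {0}"
  proof
    fix s assume s: "s \<in> S \<inter> perp (C - A)"
    have "C \<subseteq> {z. b z s = 0}"
    proof
      fix c assume "c \<in> C"
      show "c \<in> {z. b z s = 0}"
      proof (cases "c \<in> A")
        case True
        then show ?thesis using A(1) s by (auto simp: perp_def b_sym[of c s])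
      next
        case False
        then show ?thesis using \<open>c \<in> C\<close> s by (auto simp: perp_def)
      qed
    qed
    then have "span C \<subseteq> {z. b z s = 0}"
      by (rule span_minimal) (auto intro: subspaceI)
    then have "b s z = 0" if "z \<in> W" for z using that C(4) by (auto simp: b_sym[of s z])
    then show "s \<in> {0}" using W s S(2) by (auto simp: regular_def)
  qed
  then have "dim (S \<inter> perp (C - A)) = 0" by simp
  then have "dim S \<le> card (C - A)"
    using dim_le_dim_perp[of "C - A" S] finC S(1) by (metis add_0 finite_Diff)
  also have "\<dots> = card C - card A" using C(1) finC by (simp add: card_Diff_subset finite_subset)
  finally have "dim S \<le> card C - card A" .
  moreover have "card A \<le> card C" using C(1) finC by (rule card_mono[rotated])
  moreover have "card C = dim W" using C basis_card_eq_dim by blast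
  ultimately show ?thesis using ge A(4) by simp
qed

text \<open>Enlarging \<open>S\<close> by \<open>z\<close> strictly shrinks the orthogonal
  complement in \<open>W\<close>; a vector that is lost, suitably scaled, serves as
  \<open>w\<close>.\<close>

lemma perp_separates:
  assumes W: "regular W" and S: "subspace S" "S \<subseteq> W" and z: "z \<in> W" "z \<notin> S"
  obtains w where "w \<in> W" "\<And>s. s \<in> S \<Longrightarrow> b s w = 0" "b z w = 1"
proof -
  let ?T = "span (insert z S)"
  have sW: "subspace W" using W by (simp add: regular_def)
  have T: "subspace ?T" "?T \<subseteq> W" using S(2) z(1) sW span_minimal by auto
  have "dim ?T = dim S + 1" using z(2) S(1) by (simp add: dim_insert) (metis span_eq_iff)
  then have "dim (W \<inter> perp ?T) < dim (W \<inter> perp S)"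
    using dim_perp[OF W S] dim_perp[OF W T] by simp
  then have "\<not> W \<inter> perp S \<subseteq> W \<inter> perp ?T" using dim_subset by (meson leD)
  then obtain w where w: "w \<in> W" "w \<in> perp S" "w \<notin> perp (insert z S)"
    by (auto simp: perp_span)
  then have "b z w \<noteq> 0" by (auto simp: perp_def)
  then have "inverse (b z w) *s w \<in> W" "b z (inverse (b z w) *s w) = 1"
    "\<And>s. s \<in> S \<Longrightarrow> b s (inverse (b z w) *s w) = 0"
    using w(1,2) sW by (auto simp: perp_def subspace_scale)
  then show thesis using that by blast
qed

text \<open>Alternating endomorphisms of a regular \<open>W\<close>, extended by zero: skewness and
  the range condition force them to kill the orthogonal complement of \<open>W\<close>.\<close>

definition alt :: "'b set \<Rightarrow> ('b \<Rightarrow> 'b) set" where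
  "alt W = {u. lin u \<and> (\<forall>x. b x (u x) = 0) \<and> range u \<subseteq> W}"

lemma altD:
  assumes "u \<in> alt W"
  shows alt_lin: "lin u" and alt_self: "b x (u x) = 0" "b (u x) x = 0" and alt_range: "u x \<in> W"
  using assms b_sym by (auto simp: alt_def)

lemmas alt_linear = linear_simps[OF alt_lin]

lemma alt_skew:
  assumes "u \<in> alt W"
  shows "b (u x) y = - b x (u y)"
proof -
  have "b (x + y) (u (x + y)) = 0" using assms by (rule altD)
  then have "b x (u y) + b y (u x) = 0"
    by (simp add: alt_linear[OF assms] altD[OF assms] add.commute)
  then show ?thesis by (metis b_sym eq_neg_iff_add_eq_0 add.commute)
qed

definition wedge :: "'b \<Rightarrow> 'b \<Rightarrow> 'b \<Rightarrow> 'b" where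
  "wedge x y z = b y z *s x - b x z *s y"

lemma wedge_in_alt:
  assumes "subspace W" "x \<in> W" "y \<in> W"
  shows "wedge x y \<in> alt W"
  unfolding alt_def
proof (intro CollectI conjI allI subsetI)
  show "lin (wedge x y)"
    by (rule linI) (simp_all add: wedge_def algebra_simps)
  show "b z (wedge x y z) = 0" for z
    by (simp add: wedge_def b_sym[of z])
  show "z \<in> W" if "z \<in> range (wedge x y)" for z
    using that assms by (auto simp: wedge_def subspace_diff subspace_scale)
qed

text \<open>A wedge is a difference of two rank-one maps, and skewness makes their contributions add
  up. This turns trace-orthogonality to a wedge into orthogonality of vectors.\<close>

lemma trace_wedge_comp:
  assumes "u \<in> alt W"
  shows "trace (\<lambda>z. wedge x y (u z)) = 2 * b y (u x)"
proof -
  have lin: "Vector_Spaces.linear scale (*) (\<lambda>z. b w (u z))" for w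
  proof -
    interpret vs: vector_space "(*) :: 'a \<Rightarrow> 'a \<Rightarrow> 'a"
      by unfold_locales (auto simp: algebra_simps)
    show ?thesis
      by unfold_locales (simp_all add: alt_linear[OF assms])
  qed
  have "trace (\<lambda>z. wedge x y (u z)) = b y (u x) - b x (u y)"
    by (simp add: wedge_def trace_diff trace_rank_one[OF lin])
  then show ?thesis using alt_skew[OF assms, of x y] by (simp add: b_sym[of y])
qed

lemma fs_subspaceD:
  assumes "fs.subspace V"
  shows fs_subspace_0: "(\<lambda>x. 0) \<in> V"
    and fs_subspace_add: "u \<in> V \<Longrightarrow> v \<in> V \<Longrightarrow> (\<lambda>x. u x + v x) \<in> V"
    and fs_subspace_diff: "u \<in> V \<Longrightarrow> v \<in> V \<Longrightarrow> (\<lambda>x. u x - v x) \<in> V"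
    and fs_subspace_scale: "u \<in> V \<Longrightarrow> (\<lambda>x. c *s u x) \<in> V"
  using fs.subspace_0[OF assms] fs.subspace_add[OF assms, of u v]
    fs.subspace_diff[OF assms, of u v] fs.subspace_scale[OF assms, of u c]
  by (simp_all add: zero_fun_def plus_fun_def fun_diff_def fun_scale_def)

lemma fs_subspaceI:
  assumes "(\<lambda>x. 0) \<in> V" "\<And>u v. u \<in> V \<Longrightarrow> v \<in> V \<Longrightarrow> (\<lambda>x. u x + v x) \<in> V"
    and "\<And>c u. u \<in> V \<Longrightarrow> (\<lambda>x. c *s u x) \<in> V"
  shows "fs.subspace V"
  using assms by (intro fs.subspaceI) (simp_all add: zero_fun_def plus_fun_def fun_scale_def)

lemma fs_linearI:
  fixes F :: "('b \<Rightarrow> 'b) \<Rightarrow> 'c::ab_group_add"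
  assumes "vector_space s" "\<And>u v. F (\<lambda>x. u x + v x) = F u + F v"
    and "\<And>c u. F (\<lambda>x. c *s u x) = s c (F u)"
  shows "Vector_Spaces.linear (fun_scale scale) s F"
  using assms fs.vector_space_axioms
  by (simp add: Vector_Spaces.linear_iff plus_fun_def fun_scale_def)

lemma sum_fun_apply: "(\<Sum>i\<in>I. f i) x = (\<Sum>i\<in>I. f i (x::'b) :: 'b)"
  by (induction I rule: infinite_finite_induct) auto

text \<open>The matrix units of \<open>Basis\<close> span all linear maps, so one \<open>R\<close>
  serves every space of endomorphisms.\<close>

lemma lin_finite_span:
  obtains R where "finite R" "\<And>V. (\<And>u. u \<in> V \<Longrightarrow> lin u) \<Longrightarrow> V \<subseteq> fs.span R"
proof -
  let ?r = "representation Basis"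
  let ?m = "\<lambda>e e' z. ?r z e *s e'"
  let ?R = "(\<lambda>(e, e'). ?m e e') ` (Basis \<times> Basis)"
  have "u \<in> fs.span ?R" if u: "lin u" for u
  proof -
    interpret u: Vector_Spaces.linear scale scale u by fact
    have "u z = (\<Sum>e\<in>Basis. \<Sum>e'\<in>Basis. fun_scale scale (?r (u e) e') (?m e e')) z" for z
    proof -
      have "u z = u (\<Sum>e\<in>Basis. ?r z e *s e)" by (simp add: sum_representation_Basis)
      also have "\<dots> = (\<Sum>e\<in>Basis. ?r z e *s u e)" by (simp add: u.sum u.scale)
      also have "\<dots> = (\<Sum>e\<in>Basis. ?r z e *s (\<Sum>e'\<in>Basis. ?r (u e) e' *s e'))"
        by (simp add: sum_representation_Basis)
      also have "\<dots> = (\<Sum>e\<in>Basis. \<Sum>e'\<in>Basis. ?r (u e) e' *s (?r z e *s e'))"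
        by (simp add: scale_sum_right mult.commute)
      finally show ?thesis by (simp add: sum_fun_apply fun_scale_def)
    qed
    then have "u = (\<Sum>e\<in>Basis. \<Sum>e'\<in>Basis. fun_scale scale (?r (u e) e') (?m e e'))" by blast
    also have "\<dots> \<in> fs.span ?R"
      by (intro fs.span_sum fs.span_scale fs.span_base) auto
    finally show ?thesis .
  qed
  moreover have "finite ?R" using finite_Basis by simp
  ultimately show thesis using that by blast
qed

lemma fs_rank_nullity:
  assumes "Vector_Spaces.linear (fun_scale scale) s F" "fs.subspace V" "\<And>u. u \<in> V \<Longrightarrow> lin u"
  shows "fs.dim V = vector_space.dim s (F ` V) + fs.dim {v \<in> V. F v = 0}"
proof -
  obtain R where "finite R" "V \<subseteq> fs.span R" using lin_finite_span assms(3) by metis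
  then show ?thesis using rank_nullity[OF assms(1,2)] by blast
qed

lemma fs_dim_psubset:
  assumes "fs.subspace U" "fs.subspace V" "U \<subset> V" "\<And>u. u \<in> V \<Longrightarrow> lin u"
  shows "fs.dim U < fs.dim V"
proof -
  obtain R where "finite R" "V \<subseteq> fs.span R" using lin_finite_span assms(4) by metis
  then show ?thesis using fs.subspace_dim_psubset[OF assms(1-3)] by blast
qed

lemma fs_dim_mono:
  assumes "fs.subspace U" "fs.subspace V" "U \<subseteq> V" "\<And>u. u \<in> V \<Longrightarrow> lin u"
  shows "fs.dim U \<le> fs.dim V"
  using fs_dim_psubset[OF assms(1,2) _ assms(4)] assms(3) by fastforce

lemma fs_dim_eqI:
  assumes "fs.subspace U" "fs.subspace V" "U \<subseteq> V" "\<And>u. u \<in> V \<Longrightarrow> lin u" "fs.dim V \<le> fs.dim U"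
  shows "U = V"
  using fs_dim_psubset[OF assms(1,2) _ assms(4)] assms(3,5) by fastforce

end

section \<open>Nilpotent spaces of alternating endomorphisms and their trace identities\<close>

context quadratic_space
begin

definition nilspace :: "'b set \<Rightarrow> ('b \<Rightarrow> 'b) set \<Rightarrow> bool" where
  "nilspace W V \<longleftrightarrow> fs.subspace V \<and> V \<subseteq> alt W \<and> (\<forall>u\<in>V. nilpotent_endo u)"

lemma nilspaceD:
  assumes "nilspace W V"
  shows "fs.subspace V" "u \<in> V \<Longrightarrow> u \<in> alt W" "u \<in> V \<Longrightarrow> nilpotent_endo u" "u \<in> V \<Longrightarrow> lin u"
  using assms altD by (auto simp: nilspace_def)

lemma nilpotent_square: "lin u \<Longrightarrow> nilpotent_endo u \<Longrightarrow> nilpotent_endo (\<lambda>x. u (u x))"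
  using nilpotent_endo_funpow[of u 2] by (simp add: numeral_2_eq_2 comp_def)

lemma nilpotent_fourth:
  "lin u \<Longrightarrow> nilpotent_endo u \<Longrightarrow> nilpotent_endo (\<lambda>x. u (u (u (u x))))"
  using nilpotent_endo_funpow[of u 4] by (simp add: eval_nat_numeral comp_def)

lemma lin_comp: "lin u \<Longrightarrow> lin v \<Longrightarrow> lin (\<lambda>x. u (v x))"
  by (rule linI) (simp_all add: linear_simps)

lemma lin_lincomb: "lin u \<Longrightarrow> lin v \<Longrightarrow> lin (\<lambda>x. u x + c *s v x)"
  by (rule linI) (simp_all add: linear_simps algebra_simps scale_left_commute)

lemma nilspace_lincomb:
  "nilspace W V \<Longrightarrow> u \<in> V \<Longrightarrow> v \<in> V \<Longrightarrow> (\<lambda>x. u x + c *s v x) \<in> V"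
  using fs_subspace_add[OF nilspaceD(1)] fs_subspace_scale[OF nilspaceD(1)] by blast

text \<open>Polarization of the vanishing trace of squares; dividing by two is allowed.\<close>

lemma nilspace_trace_prod:
  assumes V: "nilspace W V" and u: "u \<in> V" and v: "v \<in> V"
  shows "trace (\<lambda>x. u (v x)) = 0"
proof -
  have lu: "lin u" and lv: "lin v" using nilspaceD(4)[OF V] u v by blast+
  have sq: "trace (\<lambda>x. w (w x)) = 0" if "w \<in> V" for w
    using trace_nilpotent[OF lin_comp[of w w] nilpotent_square[of w]] nilspaceD(3,4)[OF V that]
    by blast
  let ?w = "\<lambda>x. u x + 1 *s v x"
  have "trace (\<lambda>x. ?w (?w x)) = 0"
    using nilspace_lincomb[OF V u v] by (rule sq)
  then have "trace (\<lambda>x. u (v x)) + trace (\<lambda>x. v (u x)) = 0"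
    by (simp add: linear_add[OF lu] linear_add[OF lv] trace_add sq u v add.assoc)
  then show ?thesis
    using trace_commute[OF lu lv] two_neq_0 by (metis mult_2 mult_eq_0_iff)
qed

text \<open>The square of \<open>f + s g + t h\<close> under the trace. It is applied with
  \<open>u^2\<close>, \<open>uv + vu\<close>, \<open>v^2\<close> and weights \<open>t\<close>,
  \<open>t^2\<close>, to expand a fourth power as the square of a square.\<close>

lemma trace_square_expand:
  assumes "lin f" "lin g" "lin h"
  shows "trace (\<lambda>x. f (f x + s *s g x + t *s h x) + s *s g (f x + s *s g x + t *s h x)
      + t *s h (f x + s *s g x + t *s h x)) =
    trace (\<lambda>x. f (f x)) + 2 * s * trace (\<lambda>x. f (g x)) + s^2 * trace (\<lambda>x. g (g x))
      + 2 * t * trace (\<lambda>x. f (h x)) + 2 * s * t * trace (\<lambda>x. g (h x)) + t^2 * trace (\<lambda>x. h (h x))"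
proof -
  have "trace (\<lambda>x. g (f x)) = trace (\<lambda>x. f (g x))" "trace (\<lambda>x. h (f x)) = trace (\<lambda>x. f (h x))"
    "trace (\<lambda>x. h (g x)) = trace (\<lambda>x. g (h x))"
    using assms trace_commute by blast+
  then show ?thesis
    by (simp add: linear_add[OF assms(1)] linear_add[OF assms(2)] linear_add[OF assms(3)]
        linear_scale[OF assms(1)] linear_scale[OF assms(2)] linear_scale[OF assms(3)]
        scale_right_distrib trace_add trace_scale power2_eq_square algebra_simps)
qed

text \<open>The trace of the fourth power of \<open>u + t v\<close> vanishes; its words in
  \<open>u\<close> and \<open>v\<close> are grouped up to cyclic rotation. The extreme terms vanish
  because \<open>u\<close> and \<open>v\<close> are nilpotent.\<close>

lemma nilspace_trace_quartic:
  assumes V: "nilspace W V" and u: "u \<in> V" and v: "v \<in> V"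
  shows "4 * t * trace (\<lambda>x. u (u (u (v x)))) +
    t^2 * (4 * trace (\<lambda>x. u (u (v (v x)))) + 2 * trace (\<lambda>x. u (v (u (v x))))) +
    4 * t^3 * trace (\<lambda>x. u (v (v (v x)))) = 0"
proof -
  have lu: "lin u" and lv: "lin v" using nilspaceD(4)[OF V] u v by blast+
  have four: "trace (\<lambda>x. w (w (w (w x)))) = 0" if "w \<in> V" for w
  proof (rule trace_nilpotent[OF _ nilpotent_fourth])
    have "lin (\<lambda>x. w (w x))" using nilspaceD(4)[OF V that] lin_comp by blast
    then show "lin (\<lambda>x. w (w (w (w x))))" using lin_comp[of "\<lambda>x. w (w x)" "\<lambda>x. w (w x)"] by simp
  qed (use nilspaceD(3,4)[OF V that] in auto)
  let ?w = "\<lambda>x. u x + t *s v x"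
  let ?f = "\<lambda>x. u (u x)" and ?g = "\<lambda>x. u (v x) + v (u x)" and ?h = "\<lambda>x. v (v x)"
  have f: "lin ?f" and h: "lin ?h" using lin_comp[OF lu lu] lin_comp[OF lv lv] by simp_all
  have g: "lin ?g" using lin_lincomb[OF lin_comp[OF lu lv] lin_comp[OF lv lu], of 1] by simp
  have w2: "?w (?w x) = ?f x + t *s ?g x + t^2 *s ?h x" for x
    by (simp add: linear_add[OF lu] linear_scale[OF lu] linear_add[OF lv] linear_scale[OF lv]
        scale_right_distrib power2_eq_square)
  have w4: "?w (?w (?w (?w x))) = ?f (?f x + t *s ?g x + t^2 *s ?h x)
      + t *s ?g (?f x + t *s ?g x + t^2 *s ?h x) + t^2 *s ?h (?f x + t *s ?g x + t^2 *s ?h x)" for x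
    by (simp only: w2[of "?w (?w x)"]) (simp only: w2)
  have "trace (\<lambda>x. ?w (?w (?w (?w x)))) = 0"
    using nilspace_lincomb[OF V u v] by (rule four)
  then have eq: "2 * t * trace (\<lambda>x. ?f (?g x)) + t^2 * trace (\<lambda>x. ?g (?g x))
      + 2 * t^2 * trace (\<lambda>x. ?f (?h x)) + 2 * t * t^2 * trace (\<lambda>x. ?g (?h x)) = 0"
    unfolding w4 trace_square_expand[OF f g h] using four[OF u] four[OF v] by simp
  have "trace (\<lambda>x. ?f (?g x)) = 2 * trace (\<lambda>x. u (u (u (v x))))"
  proof -
    have "trace (\<lambda>x. u (u (v (u x)))) = trace (\<lambda>x. u (u (u (v x))))"
      using trace_commute[OF lu lin_comp[OF lu lin_comp[OF lu lv]]] by simp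
    then show ?thesis by (simp add: linear_add[OF lu] trace_add)
  qed
  moreover have "trace (\<lambda>x. ?g (?g x)) = 2 * trace (\<lambda>x. u (v (u (v x)))) + 2 * trace (\<lambda>x. u (u (v (v x))))"
  proof -
    have "trace (\<lambda>x. v (u (v (u x)))) = trace (\<lambda>x. u (v (u (v x))))"
      "trace (\<lambda>x. u (v (v (u x)))) = trace (\<lambda>x. u (u (v (v x))))"
      "trace (\<lambda>x. v (u (u (v x)))) = trace (\<lambda>x. u (u (v (v x))))"
      using trace_commute[OF lv lin_comp[OF lu lin_comp[OF lv lu]]] trace_commute[OF lu lin_comp[OF lu lin_comp[OF lv lv]]]
        trace_commute[OF lv lin_comp[OF lu lin_comp[OF lu lv]]] by simp_all
    then show ?thesis by (simp add: linear_add[OF lu] linear_add[OF lv] trace_add)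
  qed
  moreover have "trace (\<lambda>x. ?g (?h x)) = 2 * trace (\<lambda>x. u (v (v (v x))))"
  proof -
    have "trace (\<lambda>x. v (u (v (v x)))) = trace (\<lambda>x. u (v (v (v x))))"
      using trace_commute[OF lv lin_comp[OF lu lin_comp[OF lv lv]]] by simp
    then show ?thesis by (simp add: trace_add)
  qed
  ultimately show ?thesis using eq
    by (simp add: algebra_simps power2_eq_square power3_eq_cube)
qed

section \<open>Witt index and isotropic vectors\<close>

text \<open>The Witt index relative to \<open>W\<close>, as a relation, so that both halves of
  maximality are directly available in inductions.\<close>

definition witt :: "'b set \<Rightarrow> nat \<Rightarrow> bool" where
  "witt W k \<longleftrightarrow> (\<exists>X\<subseteq>W. totally_singular scale b X \<and> dim X = k) \<and>
     (\<forall>X\<subseteq>W. totally_singular scale b X \<longrightarrow> dim X \<le> k)"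

lemma totally_singular_span_singleton:
  "b x x = 0 \<Longrightarrow> totally_singular scale b (span {x})"
  unfolding totally_singular_def using subspace_span[of "{x}"] by (auto simp: span_singleton)

text \<open>The last nonzero vector \<open>x\<close> of the chain \<open>z, u z, ...\<close> is
  itself an image because \<open>u z\<close> is nonzero; skewness then moves \<open>u\<close> across
  \<open>b x x\<close> and produces \<open>u x = 0\<close>.\<close>

lemma nilpotent_alt_isotropic_kernel:
  assumes u: "u \<in> alt W" "nilpotent_endo u" and ne: "u z \<noteq> 0"
  obtains x where "x \<in> W" "x \<noteq> 0" "b x x = 0" "u x = 0"
proof -
  obtain k where k: "\<And>x. (u ^^ k) x = 0" using u(2) by (auto simp: nilpotent_endo_iff)
  define m where "m = (LEAST m. (u ^^ m) z = 0)"
  have m0: "(u ^^ m) z = 0" unfolding m_def using k by (rule LeastI)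
  have m1: "(u ^^ i) z \<noteq> 0" if "i < m" for i using that not_less_Least unfolding m_def by blast
  have "m \<noteq> 0" "m \<noteq> 1" using m0 ne alt_linear(4)[OF u(1)] by (metis funpow_0, force)
  then obtain l where l: "m = Suc (Suc l)" by (metis One_nat_def not0_implies_Suc)
  let ?x = "(u ^^ Suc l) z"
  have "b ?x ?x = - b ((u ^^ l) z) ((u ^^ m) z)"
    using alt_skew[OF u(1), of "(u ^^ l) z" ?x] by (simp add: l)
  then have "b ?x ?x = 0" using m0 by simp
  moreover have "?x \<in> W" using alt_range[OF u(1)] by simp
  moreover have "u ?x = 0" using m0 l by simp
  moreover have "?x \<noteq> 0" using m1 l by blast
  ultimately show thesis using that by blast
qed

lemma witt_0_nilpotent:
  assumes "witt W 0" "subspace W" "u \<in> alt W" "nilpotent_endo u"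
  shows "u = (\<lambda>x. 0)"
proof (rule ccontr)
  assume "u \<noteq> (\<lambda>x. 0)"
  then obtain z where "u z \<noteq> 0" by blast
  then obtain x where x: "x \<in> W" "x \<noteq> 0" "b x x = 0"
    using nilpotent_alt_isotropic_kernel[OF assms(3,4)] by metis
  have "dim (span {x}) \<le> 0"
    using assms(1,2) x totally_singular_span_singleton[OF x(3)]
    unfolding witt_def by (metis empty_subsetI insert_subset span_minimal)
  then show False using x(2) by simp
qed

lemma hyperbolic_partner:
  assumes "regular W" "x \<in> W" "x \<noteq> 0" "b x x = 0"
  obtains y where "y \<in> W" "b y y = 0" "b x y = 1"
proof -
  have sW: "subspace W" using assms(1) by (simp add: regular_def)
  obtain z where z: "z \<in> W" "b x z = 1"
    using perp_separates[OF assms(1) subspace_single_0 _ assms(2)] assms(3) sW subspace_0 by auto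
  \<comment> \<open>Subtracting this multiple of \<open>x\<close> cancels \<open>b z z\<close> and
    leaves the pairing with the isotropic \<open>x\<close> unchanged.\<close>
  let ?y = "z - (b z z / 2) *s x"
  have "?y \<in> W" using sW z assms(2) by (simp add: subspace_diff subspace_scale)
  moreover have "b ?y ?y = 0"
    using z(2) two_neq_0 by (simp add: assms(4) b_sym[of z x])
  moreover have "b x ?y = 1" using z(2) assms(4) by simp
  ultimately show thesis using that by blast
qed

end

section \<open>Hyperbolic pairs and splitting off a hyperbolic plane\<close>

locale hyperbolic_pair = quadratic_space +
  fixes W :: "'b set" and x y :: 'b
  assumes regular_W: "regular W"
    and xW: "x \<in> W" and yW: "y \<in> W"
    and bxx: "b x x = 0" and byy: "b y y = 0" and bxy: "b x y = 1"
begin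

lemma byx: "b y x = 1"
  using bxy b_sym by simp

lemma subspace_W: "subspace W"
  using regular_W by (simp add: regular_def)

lemma x_neq_0: "x \<noteq> 0"
  using bxy by auto

definition W' :: "'b set" where
  "W' = W \<inter> perp {x, y}"

definition pr :: "'b \<Rightarrow> 'b" where
  "pr z = z - b z y *s x - b z x *s y"

text \<open>For an alternating \<open>v\<close> killing \<open>x\<close>, this is the map induced on
  \<open>x^\<bottom> / x\<close>, transported to \<open>W'\<close> and extended by zero.\<close>

definition compress :: "('b \<Rightarrow> 'b) \<Rightarrow> 'b \<Rightarrow> 'b" where
  "compress v z = pr (v (pr z))"

lemma W'_iff: "z \<in> W' \<longleftrightarrow> z \<in> W \<and> b x z = 0 \<and> b y z = 0"
  by (simp add: W'_def perp_def)

lemma lin_pr: "lin pr"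
  by (rule linI) (simp_all add: pr_def algebra_simps)

lemma pr_simps [simp]:
  "pr x = 0" "pr y = 0" "b (pr z) x = 0" "b (pr z) y = 0" "b x (pr z) = 0" "b y (pr z) = 0"
  by (simp_all add: pr_def bxx byy bxy byx b_sym[of x z] b_sym[of y z])

lemma b_pr: "b (pr z) w = b z (pr w)"
  by (simp add: pr_def b_sym[of x w] b_sym[of y w] algebra_simps)

lemma pr_in_W': "z \<in> W \<Longrightarrow> pr z \<in> W'"
  using xW yW subspace_W by (simp add: W'_iff) (simp add: pr_def subspace_diff subspace_scale)

lemma pr_W': "z \<in> W' \<Longrightarrow> pr z = z"
  by (simp add: W'_iff pr_def b_sym[of z x] b_sym[of z y])

lemma pr_pr [simp]: "pr (pr z) = pr z"
  by (simp add: pr_def[of "pr z"])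

lemma decompose: "z = pr z + b z y *s x + b z x *s y"
  by (simp add: pr_def)

lemma subspace_W': "subspace W'"
  using subspace_W unfolding W'_def by (rule subspace_inter_perp)

lemma regular_W': "regular W'"
  unfolding regular_def
proof (intro conjI ballI impI)
  fix z assume z: "z \<in> W'" "\<forall>w\<in>W'. b z w = 0"
  have "b z w = 0" if "w \<in> W" for w
    using z pr_in_W'[OF that] b_pr[of z w] pr_W' by simp
  then show "z = 0" using z(1) regular_W by (auto simp: W'_iff regular_def)
qed (rule subspace_W')

lemma dim_W: "dim W = dim W' + 2"
proof -
  have "x \<notin> span {y}" using bxx bxy byx byy by (auto simp: span_singleton)
  then have "dim {x, y} = 2" using bxy by (auto simp: dim_insert)
  moreover have "dim (W \<inter> perp (span {x, y})) + dim (span {x, y}) = dim W"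
    by (rule dim_perp[OF regular_W subspace_span span_minimal]) (use xW yW subspace_W in auto)
  ultimately show ?thesis by (simp add: perp_span W'_def)
qed

lemma totally_singular_insert:
  assumes X: "totally_singular scale b X" and "\<And>z. z \<in> X \<Longrightarrow> b x z = 0"
  shows "totally_singular scale b (span (insert x X))"
proof -
  have "b z w = 0" if z: "z \<in> span (insert x X)" and w: "w \<in> span (insert x X)" for z w
  proof -
    have sX: "span X = X" using X by (simp add: totally_singular_def)
    obtain k where k: "z - k *s x \<in> X" using z span_breakdown_eq sX by metis
    obtain l where l: "w - l *s x \<in> X" using w span_breakdown_eq sX by metis
    have "b (z - k *s x) (w - l *s x) = 0"
      using k l X by (simp only: totally_singular_def)
    moreover have "b x (z - k *s x) = 0" "b x (w - l *s x) = 0"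
      using k l assms(2) by blast+
    ultimately show ?thesis by (simp add: bxx b_sym[of z x])
  qed
  then show ?thesis by (simp add: totally_singular_def)
qed

text \<open>Adjoining \<open>x\<close> to a totally singular subspace of \<open>W'\<close> raises
  its dimension by one. Conversely, a maximal \<open>X\<close> is cut by \<open>x^\<bottom>\<close>
  and projected. If \<open>x\<close> lies in \<open>X\<close>, only the projection can lose a
  dimension; otherwise only the cut can.\<close>

lemma witt_W':
  assumes "witt W (Suc k)"
  shows "witt W' k"
proof -
  have le: "dim X \<le> k" if X: "X \<subseteq> W'" "totally_singular scale b X" for X
  proof -
    have ts: "totally_singular scale b (span (insert x X))"
      by (rule totally_singular_insert[OF X(2)]) (use X(1) W'_iff in blast)
    have "span (insert x X) \<subseteq> W"
      by (rule span_minimal) (use X(1) xW subspace_W W'_iff in auto)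
    then have "dim (span (insert x X)) \<le> Suc k" using assms ts unfolding witt_def by blast
    moreover have "x \<notin> span X"
    proof -
      have "span X = X" using X(2) by (simp add: totally_singular_def)
      then show ?thesis using X(1) byx W'_iff by (metis subsetD zero_neq_one)
    qed
    ultimately show ?thesis by (simp add: dim_insert)
  qed
  obtain X where X: "X \<subseteq> W" "totally_singular scale b X" "dim X = Suc k"
    using assms by (auto simp: witt_def)
  have sX: "subspace X" using X(2) by (simp add: totally_singular_def)
  let ?Y = "{z \<in> X. b x z = 0}"
  have sY: "subspace ?Y"
    using subspace_inter_perp[OF sX, of "{x}"] by (simp add: perp_def Int_def)
  interpret pr: Vector_Spaces.linear scale scale pr by (rule lin_pr)
  have prY: "pr z = z - b z y *s x" if "z \<in> ?Y" for z
    using that by (simp add: pr_def b_sym[of z x])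
  let ?Z = "pr ` ?Y"
  have ker: "{z \<in> ?Y. pr z = 0} \<subseteq> span {x}"
    using prY by (auto simp: span_singleton)
  have dimY: "dim ?Y = dim ?Z + dim {z \<in> ?Y. pr z = 0}"
    by (rule rank_nullity[OF lin_pr sY finite_Basis]) (simp add: span_Basis)
  have ts: "totally_singular scale b ?Z"
    unfolding totally_singular_def
  proof (intro conjI ballI pr.subspace_image sY)
    fix z w assume "z \<in> ?Z" "w \<in> ?Z"
    then obtain z' w' where zw: "z' \<in> ?Y" "w' \<in> ?Y" "z = pr z'" "w = pr w'" by blast
    then have "b z' w' = 0" using X(2) by (simp add: totally_singular_def)
    then show "b z w = 0" using zw(1,2) by (simp add: zw(3,4) prY bxx b_sym[of z' x] b_sym[of w' x])
  qed
  have ZW: "?Z \<subseteq> W'" using X(1) pr_in_W' by blast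
  have "k \<le> dim ?Z"
  proof (cases "x \<in> X")
    case True
    then have "?Y = X" using X(2) by (auto simp: totally_singular_def)
    moreover have "dim {z \<in> ?Y. pr z = 0} \<le> dim (span {x})" using ker by (rule dim_subset)
    ultimately show ?thesis using dimY X(3) x_neq_0 by simp
  next
    case False
    have "{z \<in> ?Y. pr z = 0} \<subseteq> {0}"
    proof
      fix z assume z: "z \<in> {z \<in> ?Y. pr z = 0}"
      then obtain c where c: "z = c *s x" using ker by (auto simp: span_singleton)
      have "c = 0"
      proof (rule ccontr)
        assume "c \<noteq> 0"
        then have "x = inverse c *s z" using c by simp
        then show False using z sX False by (simp add: subspace_scale)
      qed
      then show "z \<in> {0}" using c by simp
    qed
    then have "dim {z \<in> ?Y. pr z = 0} = 0" by simp
    then have dYZ: "dim ?Y = dim ?Z" using dimY by simp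
    have "Suc k \<le> dim ?Y + 1"
      using dim_le_dim_kernel_functional[OF sX linear_b_right, of x] X(3) by simp
    then show ?thesis using dYZ by simp
  qed
  moreover have "dim ?Z \<le> k" using ZW ts by (rule le)
  ultimately show ?thesis using ZW ts le unfolding witt_def by (metis le_antisym)
qed

end

section \<open>Compression along a hyperbolic pair\<close>

context quadratic_space
begin

definition orbit :: "('b \<Rightarrow> 'b) set \<Rightarrow> 'b \<Rightarrow> 'b set" where
  "orbit V x = (\<lambda>v. v x) ` V"

definition stab :: "('b \<Rightarrow> 'b) set \<Rightarrow> 'b \<Rightarrow> ('b \<Rightarrow> 'b) set" where
  "stab V x = {v \<in> V. v x = 0}"

text \<open>The candidates \<open>w\<close> for which \<open>wedge x w\<close> may lie in
  \<open>V\<close>, as dictated by the trace form.\<close>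

definition annih :: "'b set \<Rightarrow> ('b \<Rightarrow> 'b) set \<Rightarrow> 'b \<Rightarrow> 'b set" where
  "annih W V x = W \<inter> perp (insert x (orbit V x))"

lemma annih_iff: "z \<in> annih W V x \<longleftrightarrow> z \<in> W \<and> b x z = 0 \<and> (\<forall>v\<in>V. b (v x) z = 0)"
  by (auto simp: annih_def perp_def orbit_def)

lemma linear_eval: "Vector_Spaces.linear (fun_scale scale) scale (\<lambda>v::'b \<Rightarrow> 'b. v x)"
  by (rule fs_linearI[OF vector_space_axioms]) simp_all

lemma subspace_orbit:
  assumes "fs.subspace V"
  shows "subspace (orbit V x)"
proof -
  interpret e: Vector_Spaces.linear "fun_scale scale" scale "\<lambda>v::'b \<Rightarrow> 'b. v x" by (rule linear_eval)
  show ?thesis unfolding orbit_def using assms by (rule e.subspace_image)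
qed

lemma subspace_stab:
  assumes "fs.subspace V"
  shows "fs.subspace (stab V x)"
  by (rule fs_subspaceI)
    (auto simp: stab_def intro: fs_subspace_0[OF assms] fs_subspace_add[OF assms] fs_subspace_scale[OF assms])

lemma fs_dim_orbit_stab:
  assumes "nilspace W V"
  shows "fs.dim V = dim (orbit V x) + fs.dim (stab V x)"
  unfolding orbit_def stab_def
  by (rule fs_rank_nullity[OF linear_eval]) (use nilspaceD[OF assms] in blast)+

text \<open>An element sending \<open>x\<close> to itself would have eigenvalue one. Most later
  contradictions end here.\<close>

lemma not_in_orbit:
  assumes "nilspace W V" "x \<noteq> 0"
  shows "x \<notin> orbit V x"
  using nilpotent_endo_eigen[of _ x 1] nilspaceD[OF assms(1)] assms(2)
  by (fastforce simp: orbit_def)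

lemma orbit_subset:
  assumes "nilspace W V" "s \<in> orbit V x"
  shows "s \<in> W" "b x s = 0" "b s x = 0"
proof -
  obtain v where v: "v \<in> alt W" "s = v x"
    using assms nilspaceD(2)[OF assms(1)] by (auto simp: orbit_def)
  then show "s \<in> W" "b x s = 0" "b s x = 0"
    using alt_self[OF v(1)] alt_range[OF v(1)] by simp_all
qed

lemma nilspace_stab: "nilspace W V \<Longrightarrow> nilspace W (stab V x)"
  using subspace_stab by (auto simp: nilspace_def stab_def)

lemma linear_wedge: "Vector_Spaces.linear scale (fun_scale scale) (wedge x)"
  using vector_space_axioms fs.vector_space_axioms
  by (simp add: Vector_Spaces.linear_iff wedge_def fun_scale_def fun_eq_iff algebra_simps
      scale_left_commute)

end

context hyperbolic_pair
begin

lemma lin_compress: "lin v \<Longrightarrow> lin (compress v)"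
  unfolding compress_def[abs_def] by (rule lin_comp[OF lin_pr lin_comp[OF _ lin_pr]])

lemma compress_in_alt:
  assumes "v \<in> alt W"
  shows "compress v \<in> alt W'"
  unfolding alt_def
proof (intro CollectI conjI allI image_subsetI)
  show "lin (compress v)" using assms by (intro lin_compress alt_lin)
  show "b z (compress v z) = 0" for z
    using altD(2)[OF assms, of "pr z"] by (simp add: compress_def b_pr[symmetric])
  show "compress v z \<in> W'" for z
    using pr_in_W' alt_range[OF assms] by (simp add: compress_def)
qed

lemma pr_orthogonal: "b z x = 0 \<Longrightarrow> pr z = z - b z y *s x"
  by (simp add: pr_def)

lemma alt_pr:
  assumes "v \<in> alt W" "v x = 0" "b z x = 0"
  shows "v (pr z) = v z"
  using assms by (simp add: pr_orthogonal alt_linear[OF assms(1)])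

lemma alt_image_orthogonal:
  assumes "v \<in> alt W" "v x = 0"
  shows "b (v z) x = 0"
  using alt_skew[OF assms(1), of z x] assms(2) by simp

lemma compress_nilpotent:
  assumes v: "v \<in> alt W" "v x = 0" and nil: "nilpotent_endo v"
  shows "nilpotent_endo (compress v)"
proof -
  have "(compress v ^^ Suc k) z = pr ((v ^^ Suc k) (pr z))" for k z
  proof (induction k)
    case (Suc k)
    have "(compress v ^^ Suc (Suc k)) z = compress v (pr ((v ^^ Suc k) (pr z)))"
      using Suc by simp
    also have "\<dots> = pr (v (pr ((v ^^ Suc k) (pr z))))" by (simp add: compress_def)
    also have "\<dots> = pr ((v ^^ Suc (Suc k)) (pr z))"
      using alt_pr[OF v alt_image_orthogonal[OF v]] by simp
    finally show ?case .
  qed (simp add: compress_def)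
  moreover obtain k where "\<And>z. (v ^^ k) z = 0" using nil by (auto simp: nilpotent_endo_iff)
  ultimately have "(compress v ^^ Suc k) z = 0" for z
    using linear_zero[OF lin_pr] alt_linear(4)[OF v(1)] by simp
  then show ?thesis unfolding nilpotent_endo_iff by blast
qed

lemma linear_compress: "Vector_Spaces.linear (fun_scale scale) (fun_scale scale) compress"
  by (rule fs_linearI[OF fs.vector_space_axioms])
    (simp_all add: compress_def fun_eq_iff fun_scale_def linear_simps[OF lin_pr])

lemma compress_diff: "compress (\<lambda>z. u z - v z) z = compress u z - compress v z"
  by (simp add: compress_def linear_diff[OF lin_pr])

text \<open>Such an \<open>h\<close> is determined by \<open>h y\<close>: on vectors projected by
  \<open>pr\<close> its values are multiples of \<open>x\<close>, with coefficients given by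
  skewness. Evaluating \<open>wedge x c\<close> at \<open>y\<close> dictates
  \<open>c = - h y\<close>.\<close>

lemma compress_eq_0:
  assumes h: "h \<in> alt W" "h x = 0" and "\<And>z. compress h z = 0"
  obtains c where "c \<in> W" "b x c = 0" "h = wedge x c"
proof -
  let ?c = "- h y"
  have c: "?c \<in> W" using alt_range[OF h(1)] subspace_W subspace_neg by blast
  have cx: "b x ?c = 0" using alt_image_orthogonal[OF h, of y] by (simp add: b_sym[of x "h y"])
  have cy: "b y ?c = 0" using altD(2)[OF h(1), of y] by simp
  have "h z = wedge x ?c z" for z
  proof -
    have "pr (h (pr z)) = 0" using assms(3) by (simp add: compress_def)
    then have "h (pr z) = b (h (pr z)) y *s x"
      using alt_image_orthogonal[OF h] by (simp add: pr_orthogonal)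
    also have "b (h (pr z)) y = b (pr z) ?c" using alt_skew[OF h(1), of "pr z" y] by simp
    also have "\<dots> = b z (pr ?c)" by (rule b_pr)
    also have "pr ?c = ?c" using cx cy by (simp add: pr_def b_sym[of "h y"])
    finally have hp: "h (pr z) = b z ?c *s x" .
    have "h z = h (pr z) + b z y *s h x + b z x *s h y"
      by (subst decompose[of z]) (simp only: alt_linear[OF h(1)])
    also have "\<dots> = wedge x ?c z"
      using hp h(2) by (simp add: wedge_def b_sym[of z x] b_sym[of z "h y"])
    finally show ?thesis .
  qed
  then show thesis using that c cx by blast
qed

lemma compress_wedge: "x' \<in> W' \<Longrightarrow> c \<in> W' \<Longrightarrow> compress (wedge x' c) = wedge x' c"
  using pr_W'[of x'] pr_W'[of c]
  by (simp add: compress_def wedge_def linear_simps[OF lin_pr] fun_eq_iff b_pr[symmetric])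

definition quot :: "('b \<Rightarrow> 'b) set \<Rightarrow> ('b \<Rightarrow> 'b) set" where
  "quot V = compress ` stab V x"

lemma nilspace_quot:
  assumes "nilspace W V"
  shows "nilspace W' (quot V)"
proof -
  interpret c: Vector_Spaces.linear "fun_scale scale" "fun_scale scale" compress
    by (rule linear_compress)
  show ?thesis
    unfolding nilspace_def quot_def
  proof (intro conjI c.subspace_image subspace_stab nilspaceD(1)[OF assms] image_subsetI ballI)
    show "compress v \<in> alt W'" if "v \<in> stab V x" for v
      using that nilspaceD(2)[OF assms] compress_in_alt by (simp add: stab_def)
    show "nilpotent_endo w" if "w \<in> compress ` stab V x" for w
      using that nilspaceD(2,3)[OF assms] compress_nilpotent by (auto simp: stab_def)
  qed
qed

lemma subspace_annih: "subspace (annih W V x)"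
  unfolding annih_def using subspace_W by (rule subspace_inter_perp)

lemma x_in_annih: "nilspace W V \<Longrightarrow> x \<in> annih W V x"
  using xW bxx orbit_subset(3) by (auto simp: annih_def perp_def)

lemma dim_annih:
  assumes V: "nilspace W V"
  shows "dim (annih W V x) + dim (orbit V x) + 1 = dim W"
proof -
  let ?S = "span (insert x (orbit V x))"
  have sO: "span (orbit V x) = orbit V x" using subspace_orbit[OF nilspaceD(1)[OF V]] by simp
  have "dim ?S = dim (orbit V x) + 1"
  proof -
    have "x \<notin> span (orbit V x)" using not_in_orbit[OF V x_neq_0] sO by metis
    then show ?thesis by (simp add: dim_insert)
  qed
  moreover have "dim (W \<inter> perp ?S) + dim ?S = dim W"
    by (rule dim_perp[OF regular_W subspace_span span_minimal])
      (use xW orbit_subset(1)[OF V] subspace_W in auto)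
  ultimately show ?thesis by (simp add: perp_span annih_def)
qed

text \<open>Evaluation at \<open>y\<close> shows that \<open>wedge x z = 0\<close> only for
  multiples \<open>z\<close> of \<open>x\<close>, so passing from \<open>annih\<close> to wedges
  loses exactly one dimension.\<close>

lemma dim_wedge_annih:
  assumes V: "nilspace W V"
  shows "fs.dim (wedge x ` annih W V x) + dim (orbit V x) + 2 = dim W"
proof -
  have "{z \<in> annih W V x. wedge x z = 0} = span {x}"
  proof
    show "{z \<in> annih W V x. wedge x z = 0} \<subseteq> span {x}"
    proof
      fix z assume "z \<in> {z \<in> annih W V x. wedge x z = 0}"
      then have "wedge x z y = 0" by simp
      then have "z = b z y *s x" by (simp add: wedge_def bxy)
      then show "z \<in> span {x}" by (metis rangeI span_singleton)
    qed
    have "span {x} \<subseteq> annih W V x"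
      by (rule span_minimal[OF _ subspace_annih]) (use x_in_annih[OF V] in simp)
    then show "span {x} \<subseteq> {z \<in> annih W V x. wedge x z = 0}"
      by (auto simp: span_singleton wedge_def fun_eq_iff mult.commute)
  qed
  moreover have "dim (annih W V x) = fs.dim (wedge x ` annih W V x) + dim {z \<in> annih W V x. wedge x z = 0}"
    by (rule rank_nullity[OF linear_wedge subspace_annih finite_Basis]) (simp add: span_Basis)
  ultimately have "dim (annih W V x) = fs.dim (wedge x ` annih W V x) + 1"
    using x_neq_0 by simp
  then show ?thesis using dim_annih[OF V] by simp
qed

lemma wedge_annihD:
  assumes V: "nilspace W V" and c: "c \<in> W" "b x c = 0" and "wedge x c \<in> V"
  shows "c \<in> annih W V x"
proof -
  have "b c (v x) = 0" if "v \<in> V" for v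
    using nilspace_trace_prod[OF V assms(4) that] trace_wedge_comp[OF nilspaceD(2)[OF V that], of x c]
      two_neq_0 by simp
  then show ?thesis using c using b_sym by (simp add: annih_iff)
qed

text \<open>The dimension of \<open>V\<close> splits into those of the orbit of \<open>x\<close>, of
  the quotient and of the kernel of compression. That kernel consists of wedges over
  \<open>annih\<close>, whose dimension complements that of the orbit. Equality of dimensions makes
  the kernel contain all these wedges.\<close>

lemma peel:
  assumes V: "nilspace W V"
  shows peel_le: "fs.dim V + 2 \<le> dim W + fs.dim (quot V)"
    and peel_eq: "fs.dim V + 2 = dim W + fs.dim (quot V) \<Longrightarrow> c \<in> annih W V x \<Longrightarrow> wedge x c \<in> V"
proof -
  let ?L = "annih W V x"
  let ?K = "{v \<in> stab V x. compress v = 0}"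
  interpret c: Vector_Spaces.linear "fun_scale scale" "fun_scale scale" compress
    by (rule linear_compress)
  interpret w: Vector_Spaces.linear scale "fun_scale scale" "wedge x"
    by (rule linear_wedge)
  have S: "nilspace W (stab V x)" using V by (rule nilspace_stab)
  have "fs.dim (stab V x) = fs.dim (quot V) + fs.dim ?K"
    unfolding quot_def by (rule fs_rank_nullity[OF linear_compress nilspaceD(1)[OF S] nilspaceD(4)[OF S]])
  then have dim: "fs.dim V = dim (orbit V x) + fs.dim (quot V) + fs.dim ?K"
    using fs_dim_orbit_stab[OF V, of x] by simp
  have sK: "fs.subspace ?K"
    using fs.subspace_inter[OF nilspaceD(1)[OF S] c.subspace_kernel] by (simp add: Int_def)
  have sL: "fs.subspace (wedge x ` ?L)" using subspace_annih by (rule w.subspace_image)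
  have lin: "lin v" if "v \<in> wedge x ` ?L" for v
    using that alt_lin[OF wedge_in_alt[OF subspace_W xW]] by (auto simp: annih_iff)
  have KL: "?K \<subseteq> wedge x ` ?L"
  proof
    fix v assume v: "v \<in> ?K"
    then have "v \<in> V" "v x = 0" "\<And>z. compress v z = 0" by (auto simp: stab_def fun_eq_iff)
    then obtain c where c: "c \<in> W" "b x c = 0" "v = wedge x c"
      using compress_eq_0[of v] nilspaceD(2)[OF V] by metis
    then have "c \<in> ?L" using wedge_annihD[OF V] \<open>v \<in> V\<close> by blast
    then show "v \<in> wedge x ` ?L" using c(3) by blast
  qed
  have "fs.dim ?K \<le> fs.dim (wedge x ` ?L)" using sK sL KL lin by (rule fs_dim_mono)
  then show "fs.dim V + 2 \<le> dim W + fs.dim (quot V)"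
    using dim dim_wedge_annih[OF V] by simp
  show "wedge x c \<in> V" if eq: "fs.dim V + 2 = dim W + fs.dim (quot V)" and "c \<in> ?L"
  proof -
    have "fs.dim (wedge x ` ?L) \<le> fs.dim ?K" using dim dim_wedge_annih[OF V] eq by simp
    then have "?K = wedge x ` ?L" using fs_dim_eqI[OF sK sL KL lin] by blast
    then show ?thesis using that(2) by (auto simp: stab_def)
  qed
qed

end

section \<open>The dimension bound and spaces attaining it\<close>

context quadratic_space
begin

text \<open>Integers avoid truncated subtraction: on the zero space with \<open>k = 0\<close> the
  second factor is negative.\<close>

definition bound :: "'b set \<Rightarrow> nat \<Rightarrow> int" where
  "bound W k = int k * (int (dim W) - int k - 1)"

lemma bound_Suc: "dim W = d + 2 \<Longrightarrow> dim W' = d \<Longrightarrow> bound W (Suc k) = bound W' k + int d"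
  by (simp add: bound_def algebra_simps)

lemma hyperbolic_pairI:
  assumes "regular W" "x \<in> W" "b x x = 0" "x \<noteq> 0"
  obtains y where "hyperbolic_pair scale Basis b W x y"
proof -
  obtain y where "y \<in> W" "b y y = 0" "b x y = 1"
    using hyperbolic_partner[OF assms(1,2,4,3)] by blast
  then have "hyperbolic_pair scale Basis b W x y"
    using assms by unfold_locales auto
  then show thesis by (rule that)
qed

lemma witt_Suc_isotropic:
  assumes "witt W (Suc k)"
  obtains x where "x \<in> W" "b x x = 0" "x \<noteq> 0"
proof -
  obtain X where X: "X \<subseteq> W" "totally_singular scale b X" "dim X = Suc k"
    using assms by (auto simp: witt_def)
  then have "\<not> X \<subseteq> {0}" using dim_eq_0 by (metis nat.distinct(1))
  then show thesis using that X(1,2) by (auto simp: totally_singular_def)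
qed

lemma isotropic_witt:
  assumes "witt W k" "subspace W" "x \<in> W" "b x x = 0" "x \<noteq> 0"
  shows "\<exists>l. k = Suc l"
proof -
  have "span {x} \<subseteq> W" using assms by (intro span_minimal) auto
  then have "dim (span {x}) \<le> k"
    using assms(1) totally_singular_span_singleton[OF assms(4)] by (auto simp: witt_def simp del: dim_span)
  then show ?thesis using assms(5) by (cases k) auto
qed

text \<open>Each lowering of the Witt index costs at most \<open>dim W - 2\<close>, and these costs
  add up to \<open>bound\<close>; at Witt index zero only the zero map remains.\<close>

theorem nilspace_dim_le:
  assumes "regular W" "witt W k" "nilspace W V"
  shows "int (fs.dim V) \<le> bound W k"
  using assms
proof (induction k arbitrary: W V)
  case 0
  then have "V \<subseteq> fs.span {}"
    using witt_0_nilpotent[OF 0(2)] nilspaceD(2,3)[OF 0(3)] by (auto simp: regular_def zero_fun_def)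
  then have "fs.dim V \<le> 0" using fs.dim_le_card[of V "{}"] by simp
  then show ?case by (simp add: bound_def)
next
  case (Suc k)
  obtain x where "x \<in> W" "b x x = 0" "x \<noteq> 0" using witt_Suc_isotropic Suc.prems(2) by blast
  then obtain y where "hyperbolic_pair scale Basis b W x y"
    using hyperbolic_pairI Suc.prems(1) by blast
  then interpret h: hyperbolic_pair scale Basis b W x y .
  have "int (fs.dim (h.quot V)) \<le> bound h.W' k"
    using h.regular_W' h.witt_W'[OF Suc.prems(2)] h.nilspace_quot[OF Suc.prems(3)] by (rule Suc.IH)
  then show ?case
    using h.peel_le[OF Suc.prems(3)] h.dim_W bound_Suc[OF h.dim_W refl, of k] by simp
qed

definition maxnil :: "'b set \<Rightarrow> nat \<Rightarrow> ('b \<Rightarrow> 'b) set \<Rightarrow> bool" where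
  "maxnil W k V \<longleftrightarrow> regular W \<and> witt W k \<and> nilspace W V \<and> int (fs.dim V) = bound W k"

lemma maxnilD:
  assumes "maxnil W k V"
  shows "regular W" "witt W k" "nilspace W V" "int (fs.dim V) = bound W k" "subspace W"
  using assms by (auto simp: maxnil_def regular_def)

end

context hyperbolic_pair
begin

text \<open>The bound for the quotient leaves no slack in \<open>peel_le\<close>, so the quotient is
  maximal too and the equality case of \<open>peel\<close> applies.\<close>

lemma maxnil_peel:
  assumes "maxnil W (Suc k) V"
  shows maxnil_quot: "maxnil W' k (quot V)"
    and maxnil_wedge: "c \<in> annih W V x \<Longrightarrow> wedge x c \<in> V"
proof -
  note V = maxnilD(2,3)[OF assms]
  have q: "nilspace W' (quot V)" using V(2) by (rule nilspace_quot)
  have le: "int (fs.dim (quot V)) \<le> bound W' k"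
    using nilspace_dim_le[OF regular_W' witt_W'[OF V(1)] q] .
  have *: "int (fs.dim V) = bound W' k + int (dim W')"
    using maxnilD(4)[OF assms] bound_Suc[OF dim_W refl] by simp
  have eq: "fs.dim V + 2 = dim W + fs.dim (quot V)"
    using le * peel_le[OF V(2)] dim_W by simp
  then have "int (fs.dim (quot V)) = bound W' k" using * dim_W by simp
  then show "maxnil W' k (quot V)"
    using regular_W' witt_W'[OF V(1)] q by (simp add: maxnil_def)
  show "wedge x c \<in> V" if "c \<in> annih W V x" using peel_eq[OF V(2) eq that] .
qed

end

section \<open>Orthogonality and closure under cubes\<close>

context quadratic_space
begin

lemma linear_b_comp:
  assumes "lin u"
  shows "Vector_Spaces.linear scale (*) (\<lambda>z. b w (u z))"
    and "Vector_Spaces.linear scale (*) (\<lambda>z. b (u z) w)"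
proof -
  interpret vs: vector_space "(*) :: 'a \<Rightarrow> 'a \<Rightarrow> 'a"
    by unfold_locales (auto simp: algebra_simps)
  show "Vector_Spaces.linear scale (*) (\<lambda>z. b w (u z))"
    "Vector_Spaces.linear scale (*) (\<lambda>z. b (u z) w)"
    by (unfold_locales, simp_all add: linear_simps[OF assms])
qed

lemma alt_diff: "subspace W \<Longrightarrow> u \<in> alt W \<Longrightarrow> v \<in> alt W \<Longrightarrow> (\<lambda>z. u z - v z) \<in> alt W"
  using lin_lincomb[of u v "-1"] by (auto simp: alt_def intro!: subspace_diff)

end

context hyperbolic_pair
begin

text \<open>The projections move through the product by cyclicity of the trace; what remains is a
  rank-one correction whose trace vanishes as \<open>v x = 0\<close>.\<close>

lemma trace_compress:
  assumes u: "u \<in> alt W" "u x = 0" and v: "v \<in> alt W" "v x = 0"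
  shows "trace (\<lambda>z. compress u (compress v z)) = trace (\<lambda>z. u (v z))"
proof -
  have lu: "lin u" and lv: "lin v" using u v alt_lin by auto
  have "compress u (compress v z) = pr (u (v (pr z)))" for z
    using alt_pr[OF u alt_image_orthogonal[OF v]] by (simp add: compress_def)
  then have "trace (\<lambda>z. compress u (compress v z)) = trace (\<lambda>z. pr (u (v (pr z))))" by simp
  also have "\<dots> = trace (\<lambda>z. u (v (pr z)))"
    using trace_commute[OF lin_pr lin_comp[OF lu lin_comp[OF lv lin_pr]]] by simp
  also have "\<dots> = trace (\<lambda>z. pr (u (v z)))"
    using trace_commute[OF lin_pr lin_comp[OF lu lv]] by simp
  also have "\<dots> = trace (\<lambda>z. u (v z) - b (u (v z)) y *s x)"
    using pr_orthogonal[OF alt_image_orthogonal[OF u]] by simp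
  also have "\<dots> = trace (\<lambda>z. u (v z)) - b (u (v x)) y"
    using trace_rank_one[OF linear_b_comp(2)[OF lin_comp[OF lu lv]]] by (simp add: trace_diff)
  finally show ?thesis using v(2) linear_zero[OF lu] by simp
qed

end

context quadratic_space
begin

text \<open>Compression along an isotropic vector \<open>x\<close> killed by \<open>w\<close>
  preserves trace-orthogonality, so by induction \<open>w\<close> agrees with some \<open>v\<close>
  in \<open>V\<close> up to a wedge \<open>x \<and> c\<close>.\<close>

theorem maxnil_trace_orthogonal:
  assumes "maxnil W k V" "w \<in> alt W" "nilpotent_endo w" "\<And>v. v \<in> V \<Longrightarrow> trace (\<lambda>z. w (v z)) = 0"
  shows "w \<in> V"
  using assms
proof (induction k arbitrary: W V w rule: less_induct)
  case (less k)
  note V = maxnilD[OF less.prems(1)]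
  show ?case
  proof (cases "\<forall>z. w z = 0")
    case True
    then have "w = (\<lambda>z. 0)" by blast
    then show ?thesis using fs_subspace_0[OF nilspaceD(1)[OF V(3)]] by simp
  next
    case False
    then obtain x where x: "x \<in> W" "x \<noteq> 0" "b x x = 0" "w x = 0"
      using nilpotent_alt_isotropic_kernel[OF less.prems(2,3)] by metis
    obtain l where k: "k = Suc l" using isotropic_witt[OF V(2,5) x(1,3,2)] by blast
    obtain y where "hyperbolic_pair scale Basis b W x y"
      using hyperbolic_pairI[OF V(1) x(1,3,2)] by blast
    then interpret h: hyperbolic_pair scale Basis b W x y .
    have maxl: "maxnil W (Suc l) V" using less.prems(1) k by simp
    have "h.compress w \<in> h.quot V"
    proof (rule less.IH[OF _ h.maxnil_quot[OF maxl]])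
      show "h.compress w \<in> alt h.W'" using less.prems(2) by (rule h.compress_in_alt)
      show "nilpotent_endo (h.compress w)"
        using less.prems(2) x(4) less.prems(3) by (rule h.compress_nilpotent)
      show "trace (\<lambda>z. h.compress w (v' z)) = 0" if v': "v' \<in> h.quot V" for v'
      proof -
        obtain v where v: "v \<in> V" "v x = 0" "v' = h.compress v"
          using v' by (auto simp: h.quot_def stab_def)
        then show ?thesis
          using h.trace_compress[OF less.prems(2) x(4) nilspaceD(2)[OF V(3) v(1)] v(2)]
            less.prems(4)[OF v(1)] by simp
      qed
    qed (simp add: k)
    then obtain v where v: "v \<in> V" "v x = 0" "h.compress w = h.compress v"
      by (auto simp: h.quot_def stab_def)
    let ?h = "\<lambda>z. w z - v z"
    have "?h \<in> alt W" using V(5) less.prems(2) nilspaceD(2)[OF V(3) v(1)] by (rule alt_diff)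
    then obtain c where c: "c \<in> W" "b x c = 0" "?h = wedge x c"
      using h.compress_eq_0[of ?h] v(2,3) x(4) by (auto simp: h.compress_diff)
    \<comment> \<open>Both \<open>w\<close> and \<open>v\<close> are trace-orthogonal to
      \<open>V\<close>, hence so is their difference; this puts \<open>c\<close> into
      \<open>annih\<close>.\<close>
    have "b c (u x) = 0" if u: "u \<in> V" for u
    proof -
      have "trace (\<lambda>z. wedge x c (u z)) = trace (\<lambda>z. w (u z) - v (u z))"
        by (simp add: c(3)[symmetric])
      also have "\<dots> = 0"
        using less.prems(4)[OF u] nilspace_trace_prod[OF V(3) v(1) u] by (simp add: trace_diff)
      finally show ?thesis
        using trace_wedge_comp[OF nilspaceD(2)[OF V(3) u], of x c] two_neq_0 by simp
    qed
    then have "c \<in> annih W V x" using c(1,2) b_sym by (simp add: annih_iff)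
    then have "wedge x c \<in> V" by (rule h.maxnil_wedge[OF maxl])
    then have "(\<lambda>z. v z + wedge x c z) \<in> V"
      by (rule fs_subspace_add[OF nilspaceD(1)[OF V(3)] v(1)])
    then show ?thesis by (simp add: c(3)[symmetric])
  qed
qed

definition cubic :: "('b \<Rightarrow> 'b) set \<Rightarrow> bool" where
  "cubic V \<longleftrightarrow> (\<forall>u\<in>V. (\<lambda>x. u (u (u x))) \<in> V)"

lemma four_neq_0: "(4::'a) \<noteq> 0"
  using two_neq_0 by (metis mult_eq_0_iff mult_2 numeral_Bit0)

text \<open>The values at \<open>1\<close> and \<open>-1\<close> give \<open>q = 0\<close> and
  \<open>p = - r\<close>. Separating \<open>p\<close> from \<open>r\<close> takes a further
  \<open>t\<close>, since \<open>t\<close> and \<open>t^3\<close> agree at \<open>0\<close>,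
  \<open>1\<close> and \<open>-1\<close>. This is where the size of the field enters.\<close>

lemma cubic_polynomial_zero:
  fixes p q r t :: 'a
  assumes "\<And>t. 4 * t * p + t^2 * q + 4 * t^3 * r = 0"
  shows "q = 0" and "t \<noteq> 0 \<Longrightarrow> t \<noteq> 1 \<Longrightarrow> t \<noteq> -1 \<Longrightarrow> p = 0"
proof -
  have "2 * q = (4 * 1 * p + 1^2 * q + 4 * 1^3 * r) + (4 * (-1) * p + (-1)^2 * q + 4 * (-1)^3 * r)"
    by simp
  also have "\<dots> = 0" unfolding assms by simp
  finally show q: "q = 0" using two_neq_0 by simp
  assume t: "t \<noteq> 0" "t \<noteq> 1" "t \<noteq> -1"
  have pr: "4 * (p + r) = 0" using assms[of 1] q by (simp add: algebra_simps)
  then have pr: "p = - r" using four_neq_0 by (metis mult_eq_0_iff eq_neg_iff_add_eq_0)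
  have "4 * t * (t - 1) * (t + 1) * r = 4 * t * p + t^2 * q + 4 * t^3 * r"
    unfolding q pr by (simp add: algebra_simps power3_eq_cube)
  also have "\<dots> = 0" by (rule assms)
  finally have "r = 0" using t four_neq_0 by (simp add: eq_neg_iff_add_eq_0)
  then show "p = 0" using pr by simp
qed

text \<open>The linear coefficient of the quartic trace identity says that cubes are
  trace-orthogonal to \<open>V\<close>.\<close>

lemma maxnil_cubic:
  assumes "maxnil W k V" "t \<noteq> 0" "t \<noteq> 1" "t \<noteq> (-1::'a)"
  shows "cubic V"
  unfolding cubic_def
proof
  fix u assume u: "u \<in> V"
  note V = maxnilD[OF assms(1)]
  have ua: "u \<in> alt W" and un: "nilpotent_endo u" using nilspaceD[OF V(3)] u by auto
  show "(\<lambda>x. u (u (u x))) \<in> V"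
  proof (rule maxnil_trace_orthogonal[OF assms(1)])
    show "(\<lambda>x. u (u (u x))) \<in> alt W"
      unfolding alt_def
    proof (intro CollectI conjI allI image_subsetI)
      show "lin (\<lambda>x. u (u (u x)))"
        using alt_lin[OF ua] by (simp add: Vector_Spaces.linear_iff)
      show "b x (u (u (u x))) = 0" for x
        using alt_skew[OF ua, of x "u (u x)"] alt_self[OF ua, of "u x"] by simp
      show "u (u (u x)) \<in> W" for x using ua by (rule alt_range)
    qed
    show "nilpotent_endo (\<lambda>x. u (u (u x)))"
      using nilpotent_endo_funpow[OF alt_lin[OF ua] un, of 3] by (simp add: eval_nat_numeral comp_def)
    show "trace (\<lambda>z. u (u (u (v z)))) = 0" if v: "v \<in> V" for v
      using cubic_polynomial_zero(2)[OF nilspace_trace_quartic[OF V(3) u v] assms(2-4)] .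
  qed
qed

text \<open>Half the difference of the cubes of \<open>u + v\<close> and \<open>u - v\<close>
  collects the terms of odd degree in \<open>v\<close>. Only a division by two occurs, so
  characteristic three is covered.\<close>

lemma cubic_polarize:
  assumes "nilspace W V" "cubic V" "u \<in> V" "v \<in> V"
  shows "(\<lambda>x. u (u (v x)) + u (v (u x)) + v (u (u x))) \<in> V"
proof -
  note V = nilspaceD(1)[OF assms(1)]
  have lu: "lin u" and lv: "lin v" using assms nilspaceD(4) by blast+
  have cube: "(\<lambda>x. w (w (w x))) \<in> V" if "w \<in> V" for w using that assms(2) by (simp add: cubic_def)
  let ?p = "\<lambda>x. u x + v x" and ?q = "\<lambda>x. u x - v x"
  have p: "?p \<in> V" and q: "?q \<in> V" using fs_subspaceD[OF V] assms by blast+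
  have "(\<lambda>x. ?p (?p (?p x)) - ?q (?q (?q x))) \<in> V"
    using fs_subspace_diff[OF V cube[OF p] cube[OF q]] .
  then have "(\<lambda>x. (1 / 2) *s (?p (?p (?p x)) - ?q (?q (?q x)))) \<in> V"
    by (rule fs_subspace_scale[OF V])
  then have "(\<lambda>x. (1 / 2) *s (?p (?p (?p x)) - ?q (?q (?q x))) - v (v (v x))) \<in> V"
    using fs_subspace_diff[OF V _ cube[OF assms(4)]] by blast
  moreover have "(1 / 2) *s (?p (?p (?p x)) - ?q (?q (?q x))) - v (v (v x)) =
      u (u (v x)) + u (v (u x)) + v (u (u x))" for x
  proof -
    let ?s = "u (u (v x)) + u (v (u x)) + v (u (u x)) + v (v (v x))"
    have "?p (?p (?p x)) - ?q (?q (?q x)) = ?s + ?s"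
      by (simp add: linear_add[OF lu] linear_add[OF lv] linear_diff[OF lu] linear_diff[OF lv])
    also have "\<dots> = 2 *s ?s" by (metis one_add_one scale_left_distrib scale_one)
    finally show ?thesis using two_neq_0 by simp
  qed
  ultimately show ?thesis by simp
qed

lemma cubic_polarize3:
  assumes "nilspace W V" "cubic V" "u \<in> V" "v \<in> V" "w \<in> V"
  shows "(\<lambda>x. u (v (w x)) + v (u (w x)) + u (w (v x)) + v (w (u x)) + w (u (v x)) + w (v (u x))) \<in> V"
proof -
  note V = nilspaceD(1)[OF assms(1)]
  have l: "lin u" "lin v" "lin w" using assms nilspaceD(4) by blast+
  let ?T = "\<lambda>u x. u (u (w x)) + u (w (u x)) + w (u (u x))"
  have T: "?T p \<in> V" if "p \<in> V" for p using cubic_polarize[OF assms(1,2) that assms(5)] .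
  have "(\<lambda>x. u x + v x) \<in> V" using fs_subspace_add[OF V] assms by blast
  then have "(\<lambda>x. ?T (\<lambda>x. u x + v x) x - ?T u x - ?T v x) \<in> V"
    using fs_subspace_diff[OF V fs_subspace_diff[OF V T T[OF assms(3)]] T[OF assms(4)]] by blast
  moreover have "?T (\<lambda>x. u x + v x) x - ?T u x - ?T v x =
      u (v (w x)) + v (u (w x)) + u (w (v x)) + v (w (u x)) + w (u (v x)) + w (v (u x))" for x
    by (simp add: linear_add[OF l(1)] linear_add[OF l(2)] linear_add[OF l(3)])
  ultimately show ?thesis by simp
qed

text \<open>The \<open>t^2\<close> coefficient of the quartic identity for \<open>wedge x w\<close>
  and \<open>v\<close> reduces to four times this product, since the alternating word has trace
  zero. This coefficient is isolated by \<open>t = 1\<close> and \<open>t = -1\<close> alone, so the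
  three-element field is covered.\<close>

lemma orbit_isotropic_or_annih_isotropic:
  assumes V: "nilspace W V" and x: "b x x = 0" and w: "w \<in> annih W V x" "wedge x w \<in> V"
    and s: "s \<in> orbit V x"
  shows "b s s * b w w = 0"
proof -
  obtain v where v: "v \<in> V" "s = v x" using s by (auto simp: orbit_def)
  have va: "v \<in> alt W" using nilspaceD(2)[OF V v(1)] .
  have lv: "lin v" using va by (rule alt_lin)
  let ?u = "wedge x w"
  have xw: "b x w = 0" "b w x = 0" "b s w = 0" "b w s = 0"
    using w(1) v b_sym by (auto simp: annih_iff)
  have xs: "b x s = 0" using alt_self[OF va] v(2) by simp
  have "?u (?u z) = b x z *s ((- b w w) *s x)" for z
    by (simp add: wedge_def xw x mult.commute)
  then have "trace (\<lambda>z. ?u (?u (v (v z)))) = trace (\<lambda>z. b x (v (v z)) *s ((- b w w) *s x))"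
    by simp
  also have "\<dots> = b x (v (v ((- b w w) *s x)))"
    by (rule trace_rank_one[OF linear_b_comp(1)[OF lin_comp[OF lv lv]]])
  also have "\<dots> = b s s * b w w"
    using alt_skew[OF va, of x s] by (simp add: alt_linear[OF va] v(2)[symmetric])
  finally have 1: "trace (\<lambda>z. ?u (?u (v (v z)))) = b s s * b w w" .
  have "b x (v w) = 0" using alt_skew[OF va, of x w] xw v(2) by simp
  then have "?u (v (?u z)) = 0" for z
    using alt_self[OF va, of w]
    by (simp add: wedge_def alt_linear[OF va] v(2)[symmetric] xw xs)
  then have 2: "trace (\<lambda>z. ?u (v (?u (v z)))) = 0" by (simp add: trace_zero)
  show ?thesis
    using cubic_polynomial_zero(1)[OF nilspace_trace_quartic[OF V w(2) v(1)]]
    unfolding 1 2 using four_neq_0 by simp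
qed

end

section \<open>Vectors with an orbit of minimal dimension\<close>

context quadratic_space
begin

lemma wedge_self: "wedge x (c *s x) z = 0"
  by (simp add: wedge_def mult.commute)

lemma maxnil_wedge_annih:
  assumes "maxnil W k V" "x \<in> W" "b x x = 0" "x \<noteq> 0" "c \<in> annih W V x"
  shows "wedge x c \<in> V"
proof -
  note V = maxnilD[OF assms(1)]
  obtain y where "hyperbolic_pair scale Basis b W x y"
    using hyperbolic_pairI[OF V(1) assms(2-4)] by blast
  then interpret h: hyperbolic_pair scale Basis b W x y .
  obtain l where "k = Suc l" using isotropic_witt[OF V(2,5) assms(2-4)] by blast
  then show ?thesis using h.maxnil_wedge assms(1,5) by blast
qed

definition orbit_span :: "('b \<Rightarrow> 'b) set \<Rightarrow> 'b \<Rightarrow> 'b set" where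
  "orbit_span V x = span (insert x (orbit V x))"

lemma orbit_span_iff:
  assumes "nilspace W V"
  shows "z \<in> orbit_span V x \<longleftrightarrow> (\<exists>c. z - c *s x \<in> orbit V x)"
proof -
  have "span (orbit V x) = orbit V x" using subspace_orbit[OF nilspaceD(1)[OF assms]] by simp
  then show ?thesis unfolding orbit_span_def span_breakdown_eq by (simp only:)
qed

lemma orbit_span_subset:
  assumes "nilspace W V" "subspace W" "x \<in> W"
  shows "orbit_span V x \<subseteq> W"
  unfolding orbit_span_def
  using orbit_subset(1)[OF assms(1)] assms(2,3) by (intro span_minimal) auto

lemma annih_separates:
  assumes V: "maxnil W k V" and x: "x \<in> W" and z: "z \<in> W" "z \<notin> orbit_span V x"
  obtains w where "w \<in> annih W V x" "b z w = 1"
proof -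
  obtain w where w: "w \<in> W" "\<And>s. s \<in> orbit_span V x \<Longrightarrow> b s w = 0" "b z w = 1"
    using perp_separates[OF maxnilD(1)[OF V] _ orbit_span_subset[OF maxnilD(3,5)[OF V] x] z]
    by (auto simp: orbit_span_def)
  have "w \<in> annih W V x"
    using w(1,2) span_base[of _ "insert x (orbit V x)"]
    by (auto simp: annih_def perp_def orbit_span_def)
  then show thesis using that w(3) by blast
qed

text \<open>The polarized cube of \<^term>\<open>wedge x w\<close>, \<open>g\<close> and \<open>u\<close> maps \<open>x\<close> to \<open>b w (g (u x)) *s x\<close>.\<close>

lemma stab_orbit_span:
  assumes V: "maxnil W k V" "cubic V" and x: "x \<in> W" "b x x = 0" "x \<noteq> 0"
    and g: "g \<in> stab V x" and s: "s \<in> orbit V x"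
  shows "g s \<in> orbit_span V x"
proof (rule ccontr)
  assume ns: "g s \<notin> orbit_span V x"
  note N = maxnilD(3)[OF V(1)]
  have gV: "g \<in> V" and gx: "g x = 0" using g by (auto simp: stab_def)
  have ga: "g \<in> alt W" using nilspaceD(2)[OF N gV] .
  obtain u where u: "u \<in> V" "s = u x" using s by (auto simp: orbit_def)
  obtain w where w: "w \<in> annih W V x" "b (g s) w = 1"
    using annih_separates[OF V(1) x(1) alt_range[OF ga] ns] by blast
  let ?k = "wedge x w"
  have k: "?k \<in> V" using maxnil_wedge_annih[OF V(1) x w(1)] .
  let ?r = "\<lambda>x. ?k (g (u x)) + g (?k (u x)) + ?k (u (g x)) + g (u (?k x)) + u (?k (g x)) + u (g (?k x))"
  have lu: "lin u" using nilspaceD(4)[OF N u(1)] .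
  have xs: "b x s = 0" using orbit_subset(2)[OF N s] .
  have ws: "b w s = 0" "b w x = 0" using w(1) u b_sym by (auto simp: annih_iff)
  have "?k x = 0" "?k 0 = 0" using x(2) ws by (simp_all add: wedge_def)
  moreover have "?k s = 0" using ws xs by (simp add: wedge_def)
  moreover have "?k (g s) = x"
  proof -
    have "b x (g s) = 0" using alt_skew[OF ga, of x s] gx by simp
    then show ?thesis using w(2) b_sym[of w "g s"] by (simp add: wedge_def)
  qed
  \<comment> \<open>At \<open>x\<close> only the first of the six products survives.\<close>
  ultimately have "?r x = x"
    using gx u(2) linear_zero[OF lu] alt_linear(4)[OF ga] by simp
  moreover have "?r \<in> V" using cubic_polarize3[OF N V(2) k gV u(1)] .
  ultimately have "x \<in> orbit V x" unfolding orbit_def by (metis (no_types, lifting) imageI)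
  then show False using not_in_orbit[OF N x(3)] by simp
qed

text \<open>Since \<open>g x = 0\<close>, only one term of the polarized cube survives at
  \<open>x\<close>.\<close>

lemma stab_square_orbit:
  assumes V: "nilspace W V" "cubic V" and g: "g \<in> stab V x" and s: "s \<in> orbit V x"
  shows "g (g s) \<in> orbit V x"
proof -
  have gV: "g \<in> V" and gx: "g x = 0" using g by (auto simp: stab_def)
  obtain u where u: "u \<in> V" "s = u x" using s by (auto simp: orbit_def)
  let ?r = "\<lambda>x. g (g (u x)) + g (u (g x)) + u (g (g x))"
  have "?r x = g (g s)"
    using gx u(2) linear_zero[OF nilspaceD(4)[OF V(1) gV]] linear_zero[OF nilspaceD(4)[OF V(1) u(1)]]
    by simp
  moreover have "?r \<in> V" using cubic_polarize[OF V gV u(1)] .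
  ultimately show ?thesis unfolding orbit_def by (metis (no_types, lifting) imageI)
qed

text \<open>The plane of \<open>x\<close> and \<open>y\<close> is stable under \<open>u\<close>, and
  a nilpotent map of a plane has square zero.\<close>

lemma nilpotent_plane:
  assumes u: "lin u" "nilpotent_endo u" and x: "u x = y" "y \<noteq> 0" and y: "u y \<in> span {x, y}"
  shows "u y = 0"
proof -
  obtain c d where "u y = c *s x + d *s y"
  proof -
    obtain c where "u y - c *s x \<in> span {y}" using y span_breakdown_eq by blast
    then obtain d where "u y - c *s x = d *s y" by (auto simp: span_singleton)
    then have "u y = c *s x + d *s y" by (metis add.commute diff_add_cancel)
    then show thesis by (rule that)
  qed
  then have uy: "u y = c *s x + d *s y" .
  \<comment> \<open>If \<open>x\<close> were a multiple of \<open>y\<close>, then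
    \<open>y = u x\<close> would be an eigenvector with nonzero eigenvalue.\<close>
  have indep: "a = 0 \<and> e = 0" if "a *s x + e *s y = 0" for a e
  proof -
    have "a = 0"
    proof (rule ccontr)
      assume a: "a \<noteq> 0"
      have "a *s x = - (e *s y)" using that by (simp add: eq_neg_iff_add_eq_0)
      then have "x = inverse a *s (- (e *s y))" using a by (metis scale_one scale_scale left_inverse)
      then have "x = (- (inverse a * e)) *s y" by simp
      then have xy: "y = (- (inverse a * e)) *s u y" using x(1) linear_scale[OF u(1)] by metis
      let ?k = "- (inverse a * e)"
      have "?k \<noteq> 0" using xy x(2) by auto
      then have "u y = inverse ?k *s y" by (metis xy scale_one scale_scale left_inverse)
      then show False using nilpotent_endo_eigen[OF u(2,1)] \<open>?k \<noteq> 0\<close> x(2) by (metis inverse_nonzero_iff_nonzero)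
    qed
    then show ?thesis using that x(2) by simp
  qed
  have "c = 0"
  proof (rule ccontr)
    assume c: "c \<noteq> 0"
    \<comment> \<open>With \<open>c\<close> nonzero, \<open>u\<close> acts invertibly on the plane,
      so no iterate of \<open>x\<close> vanishes.\<close>
    have "\<exists>a e. (u ^^ n) x = a *s x + e *s y \<and> (a \<noteq> 0 \<or> e \<noteq> 0)" for n
    proof (induction n)
      case 0
      have "(u ^^ 0) x = 1 *s x + 0 *s y" by simp
      then show ?case by (metis zero_neq_one)
    next
      case (Suc n)
      then obtain a e where ae: "(u ^^ n) x = a *s x + e *s y" "a \<noteq> 0 \<or> e \<noteq> 0" by blast
      then have "(u ^^ Suc n) x = (e * c) *s x + (a + e * d) *s y"
        by (simp add: linear_add[OF u(1)] linear_scale[OF u(1)] x(1) uy algebra_simps)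
      moreover have "e * c \<noteq> 0 \<or> a + e * d \<noteq> 0" using ae(2) c by auto
      ultimately show ?case by blast
    qed
    then show False using u(2) indep unfolding nilpotent_endo_iff by metis
  qed
  then have "u y = d *s y" using uy by simp
  then show ?thesis using nilpotent_endo_eigen[OF u(2,1)] x(2) by (metis scale_zero_left)
qed

lemma scale_in_orbit:
  assumes "nilspace W V" "x \<noteq> 0" "c *s x \<in> orbit V x"
  shows "c = 0"
proof (rule ccontr)
  assume c: "c \<noteq> 0"
  have "inverse c *s (c *s x) \<in> orbit V x"
    using subspace_orbit[OF nilspaceD(1)[OF assms(1)]] assms(3) by (rule subspace_scale)
  then show False using c not_in_orbit[OF assms(1,2)] by simp
qed

text \<open>The assumptions \<open>stab_y\<close> and \<open>full\<close> are what the quotient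
  provides for a vector \<open>y\<close> in its common kernel, taken modulo \<open>x\<close>.
  Minimality first yields a special element \<open>g\<close> of \<open>V\<close>; it forces
  \<open>u y\<close> out of \<open>orbit_span V x\<close>, and a cube then reaches
  \<open>x\<close>.\<close>

lemma maxnil_minimal_orbit_contradiction:
  assumes V: "maxnil W k V" "cubic V" and x: "x \<in> W" "b x x = 0" "x \<noteq> 0"
    and minimal: "\<And>z. z \<in> W \<Longrightarrow> b z z = 0 \<Longrightarrow> z \<noteq> 0 \<Longrightarrow> dim (orbit V x) \<le> dim (orbit V z)"
    and u: "u \<in> V" "u x = y" and y: "y \<noteq> 0" "b y y = 0"
    and stab_y: "\<And>g. g \<in> stab V x \<Longrightarrow> \<exists>c. g y = c *s x"
    and full: "\<And>w. w \<in> W \<Longrightarrow> b x w = 0 \<Longrightarrow> b y w = 0 \<Longrightarrow>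
      \<exists>c\<in>W. b x c = 0 \<and> (\<lambda>z. wedge y w z + wedge x c z) \<in> V"
  shows False
proof -
  note N = maxnilD(3)[OF V(1)]
  have ua: "u \<in> alt W" using nilspaceD(2)[OF N u(1)] .
  have un: "nilpotent_endo u" using nilspaceD(3)[OF N u(1)] .
  have yO: "y \<in> orbit V x" using u by (auto simp: orbit_def)
  have yW: "y \<in> W" and xy: "b x y = 0" "b y x = 0" using orbit_subset[OF N yO] by auto
  define e where "e = u y"
  have eW: "e \<in> W" using ua alt_range by (simp add: e_def)
  have ex: "b e x = 0" "b x e = 0"
    using alt_skew[OF ua, of y x] u(2) y(2) b_sym by (auto simp: e_def)
  have ey: "b e y = 0" "b y e = 0" using alt_self[OF ua] by (auto simp: e_def)
  \<comment> \<open>Trace-orthogonality to \<open>u\<close>, which sends \<open>x\<close> to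
    \<open>y\<close> and \<open>y\<close> to \<open>e\<close>.\<close>
  have trace0: "b w e + b c y = 0"
    if "(\<lambda>z. wedge y w z + wedge x c z) \<in> V" for w c
  proof -
    have "trace (\<lambda>z. wedge y w (u z) + wedge x c (u z)) = 0"
      using nilspace_trace_prod[OF N that u(1)] .
    then have "2 * (b w e + b c y) = 0"
      by (simp add: trace_add trace_wedge_comp[OF ua] u(2) e_def distrib_left)
    then show ?thesis using two_neq_0 by (metis mult_eq_0_iff)
  qed
  \<comment> \<open>Otherwise \<open>trace0\<close> makes \<open>e\<close> orthogonal to everything
    orthogonal to \<open>x\<close> and \<open>y\<close>, so \<open>e\<close> lies in their span and
    \<open>u y = 0\<close>.\<close>
  have "\<exists>w c. w \<in> W \<and> b x w = 0 \<and> b y w = 0 \<and> b x c = 0 \<and>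
    (\<lambda>z. wedge y w z + wedge x c z) \<in> V \<and> b c y \<noteq> 0"
  proof (rule ccontr)
    assume none: "\<not> ?thesis"
    have "e \<in> span {x, y}"
    proof (rule ccontr)
      assume "e \<notin> span {x, y}"
      moreover have "span {x, y} \<subseteq> W"
        using x(1) yW maxnilD(5)[OF V(1)] by (intro span_minimal) auto
      ultimately obtain w where w: "w \<in> W" "\<And>s. s \<in> span {x, y} \<Longrightarrow> b s w = 0" "b e w = 1"
        using perp_separates[OF maxnilD(1)[OF V(1)] subspace_span _ eW] by blast
      have xyw: "b x w = 0" "b y w = 0" using w(2) by (simp_all add: span_base)
      obtain c where c: "b x c = 0" "(\<lambda>z. wedge y w z + wedge x c z) \<in> V"
        using full[OF w(1) xyw] by blast
      then have "b c y = 0" using none w(1) xyw by blast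
      then show False using trace0[OF c(2)] w(3) b_sym[of w e] by simp
    qed
    then have e0: "u y = 0"
      using nilpotent_plane[OF alt_lin[OF ua] un u(2) y(1)] by (simp add: e_def)
    have stab0: "v y = 0" if v: "v \<in> stab V x" for v
    proof (rule ccontr)
      assume vy: "v y \<noteq> 0"
      obtain c where c: "v y = c *s x" using stab_y[OF v] by blast
      have vV: "v \<in> V" and vx: "v x = 0" using v by (auto simp: stab_def)
      \<comment> \<open>This combination would exchange \<open>x\<close> and \<open>y\<close>, so
        its square would fix \<open>x\<close>.\<close>
      let ?w = "\<lambda>z. u z + inverse c *s v z"
      have wV: "?w \<in> V" using nilspace_lincomb[OF N u(1) vV] .
      have "c \<noteq> 0" using vy c by auto
      then have "?w (?w x) = 1 *s x" using u(2) vx c e0 by simp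
      then show False
        using nilpotent_endo_eigen[OF nilpotent_square[OF nilspaceD(4)[OF N wV] nilspaceD(3)[OF N wV]]
            lin_comp[OF nilspaceD(4)[OF N wV] nilspaceD(4)[OF N wV]]] x(3) one_neq_zero by blast
    qed
    then have "stab V x \<subseteq> stab V y" by (auto simp: stab_def)
    moreover have "u \<in> stab V y" "u \<notin> stab V x" using u y(1) e0 by (auto simp: stab_def)
    \<comment> \<open>A larger stabilizer means a smaller orbit, against the minimal choice of
      \<open>x\<close>.\<close>
    ultimately have "fs.dim (stab V x) < fs.dim (stab V y)"
      using subspace_stab[OF nilspaceD(1)[OF N]] nilspaceD(4)[OF nilspace_stab[OF N]]
      by (intro fs_dim_psubset) auto
    then have "dim (orbit V y) < dim (orbit V x)"
      using fs_dim_orbit_stab[OF N, of x] fs_dim_orbit_stab[OF N, of y] by simp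
    then show False using minimal[OF yW y(2,1)] by simp
  qed
  then obtain w c where w: "w \<in> W" "b x w = 0" "b y w = 0" and c: "b x c = 0" "b c y \<noteq> 0"
    and gV: "(\<lambda>z. wedge y w z + wedge x c z) \<in> V"
    by blast
  define g where "g = (\<lambda>z. wedge y w z + wedge x c z)"
  have gx: "g x = 0" using w c x(2) xy b_sym by (simp add: g_def wedge_def)
  have gstab: "g \<in> stab V x" using gV gx by (simp add: stab_def g_def)
  have lg: "lin g" using nilspaceD(4)[OF N] gV by (simp add: g_def)
  have gy: "g y = b c y *s x" using w xy y(2) b_sym by (simp add: g_def wedge_def)
  \<comment> \<open>The map \<open>g\<close> sends \<open>s\<close> into the span of
    \<open>x\<close> and \<open>y\<close>, and \<open>y\<close> to a nonzero multiple of
    \<open>x\<close>; its square keeps \<open>s\<close> in the orbit, which meets the line of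
    \<open>x\<close> only in zero.\<close>
  have orth: "b w s = 0" if s: "s \<in> orbit V x" "b y s = 0" for s
  proof -
    have "g s = b w s *s y + b c s *s x"
      using s(2) orbit_subset[OF N s(1)] by (simp add: g_def wedge_def)
    then have "g (g s) = (b w s * b c y) *s x"
      by (simp add: linear_add[OF lg] linear_scale[OF lg] gx gy)
    then have "(b w s * b c y) *s x \<in> orbit V x"
      using stab_square_orbit[OF N V(2) gstab s(1)] by simp
    then have "b w s * b c y = 0" by (rule scale_in_orbit[OF N x(3)])
    then show ?thesis using c(2) by simp
  qed
  \<comment> \<open>Membership would give \<open>b w e = 0\<close> by \<open>orth\<close>, so
    \<open>trace0\<close> would make \<open>b c y\<close> vanish.\<close>
  have "e \<notin> orbit_span V x"
  proof
    assume "e \<in> orbit_span V x"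
    then obtain a where a: "e - a *s x \<in> orbit V x" using orbit_span_iff[OF N] by blast
    have "b w (e - a *s x) = 0" by (rule orth[OF a]) (simp add: ey xy)
    then have "b w e = 0" using w(2) b_sym[of w x] by simp
    then show False using trace0[OF gV] c(2) by simp
  qed
  then obtain w' where w': "w' \<in> annih W V x" "b e w' = 1"
    using annih_separates[OF V(1) x(1) eW] by blast
  let ?k = "wedge x w'"
  have kV: "?k \<in> V" using maxnil_wedge_annih[OF V(1) x w'(1)] .
  let ?n = "\<lambda>z. u z + 1 *s ?k z"
  have nV: "?n \<in> V" using nilspace_lincomb[OF N u(1) kV] .
  have w'x: "b w' x = 0" "b w' y = 0" "b w' e = 1"
    using w' u b_sym by (auto simp: annih_iff)
  have "?n x = y" using w'x x(2) u(2) by (simp add: wedge_def)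
  moreover have "?n y = e" using w'x xy by (simp add: wedge_def e_def)
  moreover have "?n e = u (u (u x)) + x" using w'x ex u(2) by (simp add: wedge_def e_def)
  ultimately have n3: "?n (?n (?n x)) = u (u (u x)) + x" by metis
  have O: "v (v (v x)) \<in> orbit V x" if "v \<in> V" for v
    using V(2) that unfolding cubic_def orbit_def by (metis (mono_tags, lifting) imageI)
  \<comment> \<open>Both cubes lie in \<open>V\<close>, and their values at \<open>x\<close> differ
    by \<open>x\<close>.\<close>
  have "u (u (u x)) + x - u (u (u x)) \<in> orbit V x"
    using subspace_diff[OF subspace_orbit[OF nilspaceD(1)[OF N]] O[OF nV] O[OF u(1)]] n3 by metis
  then show False using not_in_orbit[OF N x(3)] by simp
qed

end

section \<open>A common isotropic kernel vector\<close>

context hyperbolic_pair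
begin

lemma quotE:
  assumes "v \<in> quot V"
  obtains g where "g \<in> V" "g x = 0" "v = compress g"
  using assms by (auto simp: quot_def stab_def)

text \<open>As the quotient kills \<open>z\<close>, the orbit of \<open>z\<close> imposes no
  condition beyond orthogonality to \<open>z\<close>.\<close>

lemma wedge_in_quot:
  assumes V: "maxnil W (Suc k) V" and z: "z \<in> W'" "b z z = 0" "z \<noteq> 0" "\<forall>v\<in>quot V. v z = 0"
    and w: "w \<in> W'" "b z w = 0"
  shows "wedge z w \<in> quot V"
proof (rule maxnil_wedge_annih[OF maxnil_quot[OF V] z(1-3)])
  show "w \<in> annih W' (quot V) z" unfolding annih_iff using w z(4) b_simps(7) by metis
qed

lemma pr_orbit_span:
  assumes V: "nilspace W V" and z: "z \<in> orbit_span V x"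
  shows "b z x = 0" "pr z \<in> W'" "pr z \<in> orbit_span V x"
proof -
  obtain c where c: "z - c *s x \<in> orbit V x" using z orbit_span_iff[OF V] by blast
  then have "b (z - c *s x) x = 0" using orbit_subset(3)[OF V] by blast
  then show zx: "b z x = 0" using bxx by simp
  show "pr z \<in> W'" using pr_in_W' orbit_span_subset[OF V subspace_W xW] z by blast
  have "x \<in> orbit_span V x" unfolding orbit_span_def by (rule span_base) simp
  then show "pr z \<in> orbit_span V x"
    using z unfolding pr_orthogonal[OF zx] orbit_span_def by (intro span_diff span_scale)
qed

lemma quot_orbit_span:
  assumes V: "maxnil W (Suc k) V" "cubic V" and v: "v \<in> quot V"
    and z: "z \<in> orbit_span V x" "z \<in> W'"
  shows "v z \<in> orbit_span V x"
proof -
  note N = maxnilD(3)[OF V(1)]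
  obtain g where g: "g \<in> V" "g x = 0" "v = compress g" using v by (rule quotE)
  have lg: "lin g" using nilspaceD(4)[OF N g(1)] .
  obtain c where c: "z - c *s x \<in> orbit V x" using z orbit_span_iff[OF N] by blast
  have "g (z - c *s x) \<in> orbit_span V x"
    using stab_orbit_span[OF V xW bxx x_neq_0 _ c] g by (simp add: stab_def)
  then have "g z \<in> orbit_span V x" by (simp add: linear_diff[OF lg] linear_scale[OF lg] g(2))
  then show ?thesis using pr_orbit_span(3)[OF N] pr_W'[OF z(2)] by (simp add: g(3) compress_def)
qed

text \<open>Compressing \<open>v\<close> along a hyperbolic pair through \<open>z\<close> gives
  values both on the line of \<open>z\<close> and orthogonal to its partner, hence zero. So
  \<open>v = z \<and> c\<close> with \<open>c\<close> a multiple of \<open>z\<close>.\<close>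

lemma quot_trivial:
  assumes V: "maxnil W (Suc k) V" and z: "z \<in> W'" "b z z = 0" "z \<noteq> 0" "\<forall>v\<in>quot V. v z = 0"
    and dim: "\<And>w. w \<in> W' \<Longrightarrow> b z w = 0 \<Longrightarrow> w \<in> span {z}" and v: "v \<in> quot V"
  shows "v w = 0"
proof -
  note Q = maxnil_quot[OF V]
  have va: "v \<in> alt W'" using nilspaceD(2)[OF maxnilD(3)[OF Q] v] .
  obtain z' where "hyperbolic_pair scale Basis b W' z z'"
    using hyperbolic_pairI[OF regular_W' z(1-3)] by blast
  then interpret h: hyperbolic_pair scale Basis b W' z z' .
  have "h.compress v p = 0" for p
  proof -
    have "h.compress v p \<in> h.W'" using alt_range[OF h.compress_in_alt[OF va]] .
    then have *: "h.compress v p \<in> W'" "b z (h.compress v p) = 0" "b z' (h.compress v p) = 0"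
      by (auto simp: h.W'_iff)
    then obtain c where "h.compress v p = c *s z" using dim by (auto simp: span_singleton)
    then show ?thesis using *(3) h.byx by simp
  qed
  then obtain c where c: "c \<in> W'" "b z c = 0" "v = wedge z c"
    using h.compress_eq_0[OF va bspec[OF z(4) v]] by blast
  then obtain a where "c = a *s z" using dim by (auto simp: span_singleton)
  then show ?thesis using c(3) wedge_self by simp
qed

text \<open>If the given \<open>z\<close> lies outside \<open>S = orbit_span V x\<close>, stability
  of the part of \<open>S\<close> in \<open>W'\<close> under the quotient forces
  \<open>z^\<bottom>\<close> in \<open>W'\<close> to be the line of \<open>z\<close>. The quotient
  is then zero, and any nonzero isotropic vector of that part serves.\<close>

lemma quot_killed_in_orbit_span:
  assumes V: "maxnil W (Suc k) V" "cubic V" and s: "s \<in> orbit V x" "s \<noteq> 0"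
    and z: "z \<in> W'" "b z z = 0" "z \<noteq> 0" "\<forall>v\<in>quot V. v z = 0"
  obtains p where "p \<in> W'" "b p p = 0" "p \<noteq> 0" "\<forall>v\<in>quot V. v p = 0" "p \<in> orbit_span V x"
proof (cases "z \<in> orbit_span V x")
  case True
  then show thesis using that z by blast
next
  case False
  note N = maxnilD(3)[OF V(1)]
  let ?S = "orbit_span V x"
  have sS: "subspace ?S" by (simp add: orbit_span_def)
  \<comment> \<open>A wedge \<open>z \<and> w\<close> in the quotient with \<open>b q w = 1\<close>
    would carry \<open>q\<close> to \<open>z\<close> and so put \<open>z\<close> into
    \<open>S\<close>.\<close>
  have case1: False if q: "q \<in> ?S" "q \<in> W'" "q \<noteq> 0" "b z q = 0" for q
  proof (cases "q \<in> span {z}")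
    case True
    then obtain c where c: "q = c *s z" by (auto simp: span_singleton)
    then have "z = inverse c *s q" using q(3) by simp
    then show False using False q(1) sS subspace_scale by blast
  next
    case nq: False
    have "span {z} \<subseteq> W'" using z(1) subspace_W' by (intro span_minimal) auto
    then obtain w where w: "w \<in> W'" "\<And>s. s \<in> span {z} \<Longrightarrow> b s w = 0" "b q w = 1"
      using perp_separates[OF regular_W' subspace_span _ q(2) nq] by blast
    have "b z w = 0" by (rule w(2)) (simp add: span_base)
    then have "wedge z w \<in> quot V" using wedge_in_quot[OF V(1) z] w(1) by blast
    then have "wedge z w q \<in> ?S" using quot_orbit_span[OF V] q by blast
    then show False using False w(3) q(4) b_sym[of w q] by (simp add: wedge_def)
  qed
  define q where "q = pr s"
  have sSp: "s \<in> ?S" using s(1) by (auto simp: orbit_span_def intro: span_base)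
  have sq: "s = q + b s y *s x"
    unfolding q_def using pr_orthogonal[OF pr_orbit_span(1)[OF N sSp]] by simp
  have q: "q \<in> ?S" "q \<in> W'" using pr_orbit_span[OF N sSp] by (auto simp: q_def)
  have q0: "q \<noteq> 0"
  proof
    assume "q = 0"
    then have "b s y *s x \<in> orbit V x" using sq s(1) by simp
    then have "b s y = 0" by (rule scale_in_orbit[OF N x_neq_0])
    then show False using sq \<open>q = 0\<close> s(2) by simp
  qed
  have zq: "b z q \<noteq> 0" using case1 q q0 by blast
  \<comment> \<open>Otherwise \<open>z \<and> w\<close> maps \<open>q\<close> to a nonzero vector of
    \<open>S\<close> orthogonal to \<open>z\<close>, excluded by \<open>case1\<close>.\<close>
  have dim: "w \<in> span {z}" if w: "w \<in> W'" "b z w = 0" for w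
  proof (rule ccontr)
    assume nw: "w \<notin> span {z}"
    let ?r = "wedge z w q"
    have "?r \<in> ?S" using quot_orbit_span[OF V wedge_in_quot[OF V(1) z w] q] .
    moreover have "?r \<in> W'" using z(1) w(1) subspace_W' by (simp add: wedge_def subspace_diff subspace_scale)
    moreover have "?r \<noteq> 0"
    proof
      assume "?r = 0"
      then have "w = inverse (b z q) *s (b w q *s z)"
        using zq by (simp add: wedge_def) 
      then show False using nw by (metis span_base span_scale insertI1)
    qed
    moreover have "b z ?r = 0" using z(2) w(2) by (simp add: wedge_def)
    ultimately show False using case1 by blast
  qed
  have triv: "v w = 0" if "v \<in> quot V" for v w
    using quot_trivial[OF V(1) z dim that] .
  show thesis
  proof (cases "b q q = 0")
    case True
    then show thesis using that q q0 triv by blast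
  next
    case nq: False
    \<comment> \<open>Chosen orthogonal to \<open>q\<close> with \<open>b w w = - b q q\<close>. The
      part of \<open>S\<close> in \<open>W'\<close> is the line of \<open>q\<close>, so
      \<open>w\<close> lies in \<open>annih\<close>; the product of norms would then have to
      vanish.\<close>
    define w where "w = q - (b q q / b z q) *s z"
    have wW: "w \<in> W'" using q(2) z(1) subspace_W' by (simp add: w_def subspace_diff subspace_scale)
    have qw: "b q w = 0" using zq b_sym[of q z] by (simp add: w_def)
    have ww: "b w w = - b q q" using zq z(2) b_sym[of q z] by (simp add: w_def)
    have perp: "b p w = 0" if p: "p \<in> ?S" "p \<in> W'" for p
    proof -
      have "p - (b z p / b z q) *s q \<in> span {z}"
        by (rule dim) (use p q(2) subspace_W' zq in \<open>auto simp: subspace_diff subspace_scale\<close>)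
      then obtain a where a: "p - (b z p / b z q) *s q = a *s z" by (auto simp: span_singleton)
      have "a *s z \<in> ?S" unfolding a[symmetric] using p q sS by (simp add: subspace_diff subspace_scale)
      then have "a \<noteq> 0 \<Longrightarrow> z \<in> ?S" using subspace_scale[OF sS, of "a *s z" "inverse a"] by simp
      then have "a = 0" using False by blast
      then have "p = (b z p / b z q) *s q" using a by simp
      then show ?thesis using qw by (metis b_simps(9) mult_zero_right)
    qed
    have "w \<in> annih W V x"
      unfolding annih_iff
    proof (intro conjI ballI)
      show "w \<in> W" "b x w = 0" using wW by (auto simp: W'_iff)
      fix v assume "v \<in> V"
      then have vS: "v x \<in> ?S" by (auto simp: orbit_span_def orbit_def intro: span_base)
      have "v x = pr (v x) + b (v x) y *s x"
        using pr_orthogonal[OF pr_orbit_span(1)[OF N vS]] by simp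
      moreover have "b (pr (v x)) w = 0" using perp pr_orbit_span[OF N vS] by blast
      ultimately show "b (v x) w = 0" using \<open>b x w = 0\<close> by (metis b_simps(1,9) add.right_neutral mult_zero_right)
    qed
    then have "b s s * b w w = 0"
      using orbit_isotropic_or_annih_isotropic[OF N bxx _ maxnil_wedge[OF V(1)] s(1)] by blast
    moreover have "b s s = b q q"
      using q(2) bxx b_sym[of q x] by (subst (1 2) sq) (simp add: W'_iff)
    ultimately show thesis using nq ww by simp
  qed
qed

text \<open>A lift to \<open>V\<close> of \<open>z \<and> w'\<close>, for the projection
  \<open>w'\<close> of \<open>w\<close>, differs from it only by a wedge with \<open>x\<close>. This
  supplies the assumption \<open>full\<close> of the minimal orbit argument.\<close>

lemma lift_wedge:
  assumes V: "maxnil W (Suc k) V" and z: "z \<in> W'" "b z z = 0" "z \<noteq> 0" "\<forall>v\<in>quot V. v z = 0"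
    and w: "w \<in> W" "b x w = 0" "b (z - a *s x) w = 0"
  shows "\<exists>c\<in>W. b x c = 0 \<and> (\<lambda>p. wedge (z - a *s x) w p + wedge x c p) \<in> V"
proof -
  note N = maxnilD(3)[OF V]
  have zx: "b x z = 0" "b z x = 0" and zW: "z \<in> W" using z(1) b_sym by (auto simp: W'_iff)
  define w' where "w' = pr w"
  have w': "w' \<in> W'" "w = w' + b w y *s x"
    using pr_in_W'[OF w(1)] w(2) b_sym[of w x] by (simp_all add: w'_def pr_def)
  have w'W: "w' \<in> W" "b x w' = 0" using w'(1) by (auto simp: W'_iff)
  have "b z w' = b (z - a *s x) w"
    using w(2) by (simp add: w'_def b_pr[symmetric] pr_W'[OF z(1)])
  then have "wedge z w' \<in> quot V" using wedge_in_quot[OF V z w'(1)] w(3) by simp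
  then obtain g where g: "g \<in> V" "g x = 0" "wedge z w' = compress g" by (rule quotE)
  let ?h = "\<lambda>p. g p - wedge z w' p"
  have "?h \<in> alt W"
    by (rule alt_diff[OF subspace_W nilspaceD(2)[OF N g(1)] wedge_in_alt[OF subspace_W zW w'W(1)]])
  moreover have "?h x = 0" using g(2) w'W(2) zx b_sym[of w' x] by (simp add: wedge_def)
  moreover have "compress ?h p = 0" for p
    using compress_wedge[OF z(1) w'(1)] g(3) by (simp add: compress_diff)
  ultimately obtain c where c: "c \<in> W" "b x c = 0" "?h = wedge x c"
    using compress_eq_0 by metis
  \<comment> \<open>Expanding the wedge of \<open>z - a x\<close> with \<open>w' + b w y x\<close>
    leaves \<open>z \<and> w'\<close> minus the wedge of \<open>x\<close> with the last two
    summands; adding them compensates.\<close>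
  let ?c = "c + b w y *s z + a *s w'"
  have eq: "wedge (z - a *s x) w p + wedge x ?c p = g p" for p
  proof -
    have "g p = wedge z w' p + wedge x c p" by (simp add: c(3)[symmetric])
    then show ?thesis
      by (subst w'(2)) (simp add: wedge_def algebra_simps)
  qed
  have "?c \<in> W" using c(1) zW w'W(1) subspace_W by (simp add: subspace_add subspace_scale)
  moreover have "b x ?c = 0" using c(2) zx w'W(2) by simp
  moreover have "(\<lambda>p. wedge (z - a *s x) w p + wedge x ?c p) \<in> V" using g(1) by (simp add: eq)
  ultimately show ?thesis by blast
qed

end

context quadratic_space
begin

text \<open>Witt index one is settled by the \<open>t^2\<close> coefficient of the quartic identity
  instead of closure under cubes, so it covers the three-element field. A nonzero \<open>u\<close>
  in \<open>V\<close> is \<open>x \<and> c\<close> with \<open>c\<close> anisotropic, which makes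
  the orbit of \<open>x\<close> totally isotropic.\<close>

lemma maxnil_common_kernel_1:
  assumes V: "maxnil W (Suc 0) V"
  shows "\<exists>x\<in>W. x \<noteq> 0 \<and> b x x = 0 \<and> (\<forall>v\<in>V. v x = 0)"
proof (cases "\<exists>u\<in>V. \<exists>z. u z \<noteq> 0")
  case False
  obtain x where "x \<in> W" "b x x = 0" "x \<noteq> 0" using witt_Suc_isotropic maxnilD(2)[OF V] by blast
  then show ?thesis using False by blast
next
  case True
  then obtain u z where u: "u \<in> V" "u z \<noteq> 0" by blast
  note N = maxnilD(3)[OF V]
  obtain x where x: "x \<in> W" "x \<noteq> 0" "b x x = 0" "u x = 0"
    using nilpotent_alt_isotropic_kernel[OF nilspaceD(2)[OF N u(1)] nilspaceD(3)[OF N u(1)] u(2)]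
    by blast
  obtain y where "hyperbolic_pair scale Basis b W x y"
    using hyperbolic_pairI[OF maxnilD(1)[OF V] x(1,3,2)] by blast
  then interpret h: hyperbolic_pair scale Basis b W x y .
  have w0: "witt h.W' 0" using h.witt_W' maxnilD(2)[OF V] by blast
  \<comment> \<open>\<open>W'\<close> has Witt index zero, so the projection of such a
    \<open>p\<close> vanishes.\<close>
  have anis: "p \<in> span {x}" if p: "p \<in> W" "b x p = 0" "b p p = 0" for p
  proof -
    have pp: "h.pr p = p - b p y *s x" using h.pr_orthogonal p(2) b_sym by simp
    then have "b (h.pr p) (h.pr p) = 0" using p x(3) b_sym[of p x] by simp
    then have "h.pr p = 0"
      using isotropic_witt[OF w0 h.subspace_W' h.pr_in_W'[OF p(1)]] by blast
    then have "p = b p y *s x" using pp by simp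
    then show ?thesis by (metis rangeI span_singleton)
  qed
  have "h.compress u \<in> h.quot V" using u(1) x(4) by (auto simp: h.quot_def stab_def)
  then have "h.compress u = (\<lambda>p. 0)"
    using witt_0_nilpotent[OF w0 h.subspace_W'] nilspaceD(2,3)[OF h.nilspace_quot[OF N]] by blast
  then have "h.compress u p = 0" for p by simp
  then obtain c where c: "c \<in> W" "b x c = 0" "u = wedge x c"
    using h.compress_eq_0[OF nilspaceD(2)[OF N u(1)] x(4)] by blast
  have ca: "c \<in> annih W V x" using h.wedge_annihD[OF N c(1,2)] c(3) u(1) by simp
  have "b c c \<noteq> 0"
  proof
    assume "b c c = 0"
    then obtain a where "c = a *s x" using anis c(1,2) by (auto simp: span_singleton)
    then show False using u(2) c(3) wedge_self by simp
  qed
  have "v x = 0" if v: "v \<in> V" for v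
  proof -
    have vO: "v x \<in> orbit V x" using v by (simp add: orbit_def)
    have "b (v x) (v x) = 0"
      using orbit_isotropic_or_annih_isotropic[OF N x(3) ca _ vO] c(3) u(1) \<open>b c c \<noteq> 0\<close> by simp
    then have "v x \<in> span {x}" using anis orbit_subset[OF N vO] by blast
    then obtain a where a: "v x = a *s x" by (auto simp: span_singleton)
    then show ?thesis using scale_in_orbit[OF N x(2)] vO by simp
  qed
  then show ?thesis using x by blast
qed

text \<open>Induction on the Witt index \<open>Suc k\<close>: the quotient has a common kernel
  vector, and an \<open>x\<close> with minimal nonzero orbit contradicts the preceding
  analysis.\<close>

theorem maxnil_common_kernel:
  assumes "maxnil W (Suc k) V" "k > 0 \<Longrightarrow> \<exists>t::'a. t \<noteq> 0 \<and> t \<noteq> 1 \<and> t \<noteq> -1"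
  shows "\<exists>x\<in>W. x \<noteq> 0 \<and> b x x = 0 \<and> (\<forall>v\<in>V. v x = 0)"
  using assms
proof (induction k arbitrary: W V)
  case 0
  then show ?case by (intro maxnil_common_kernel_1)
next
  case (Suc k)
  note V = Suc.prems(1)
  note N = maxnilD(3)[OF V]
  have cub: "cubic V" using maxnil_cubic[OF V] Suc.prems(2) by blast
  let ?P = "\<lambda>x. x \<in> W \<and> b x x = 0 \<and> x \<noteq> 0"
  obtain x0 where "?P x0" using witt_Suc_isotropic maxnilD(2)[OF V] by blast
  then obtain x where x: "?P x" and min: "\<And>z. ?P z \<Longrightarrow> dim (orbit V x) \<le> dim (orbit V z)"
    using ex_has_least_nat[of ?P x0 "\<lambda>x. dim (orbit V x)"] by blast
  show ?case
  proof (cases "\<exists>v\<in>V. v x \<noteq> 0")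
    case False
    then show ?thesis using x by blast
  next
    case True
    then obtain s where s: "s \<in> orbit V x" "s \<noteq> 0" by (auto simp: orbit_def)
    obtain y where "hyperbolic_pair scale Basis b W x y"
      using hyperbolic_pairI[OF maxnilD(1)[OF V]] x by blast
    then interpret h: hyperbolic_pair scale Basis b W x y .
    obtain z0 where "z0 \<in> h.W'" "z0 \<noteq> 0" "b z0 z0 = 0" "\<forall>v\<in>h.quot V. v z0 = 0"
      using Suc.IH[OF h.maxnil_quot[OF V]] Suc.prems(2) by blast
    then obtain z where z: "z \<in> h.W'" "b z z = 0" "z \<noteq> 0" "\<forall>v\<in>h.quot V. v z = 0"
      and zS: "z \<in> orbit_span V x"
      using h.quot_killed_in_orbit_span[OF V cub s] by metis
    \<comment> \<open>Subtracting a multiple of \<open>x\<close> moves \<open>z\<close> into the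
      orbit; it stays isotropic and nonzero because \<open>z\<close> is orthogonal to
      \<open>x\<close> and \<open>y\<close>.\<close>
    obtain a where a: "z - a *s x \<in> orbit V x" using zS orbit_span_iff[OF N] by blast
    then obtain u where u: "u \<in> V" "u x = z - a *s x" by (auto simp: orbit_def)
    have zx: "b x z = 0" "b z x = 0" "b z y = 0" using z(1) b_sym by (auto simp: h.W'_iff)
    have False
    proof (rule maxnil_minimal_orbit_contradiction[OF V cub _ _ _ _ u])
      show "x \<in> W" "b x x = 0" "x \<noteq> 0" using x by auto
      show "dim (orbit V x) \<le> dim (orbit V p)" if "p \<in> W" "b p p = 0" "p \<noteq> 0" for p
        using min that by blast
      show "z - a *s x \<noteq> 0"
      proof
        assume "z - a *s x = 0"
        then have "z = a *s x" by simp
        then have "a = 0" using zx(3) h.bxy by simp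
        then show False using \<open>z = a *s x\<close> z(3) by simp
      qed
      show "b (z - a *s x) (z - a *s x) = 0" using z(2) zx x by simp
      show "\<exists>c. g (z - a *s x) = c *s x" if g: "g \<in> stab V x" for g
      proof -
        have gV: "g \<in> V" "g x = 0" using g by (auto simp: stab_def)
        then have "h.compress g \<in> h.quot V" using g by (simp add: h.quot_def)
        then have "h.pr (g z) = 0" using bspec[OF z(4), of "h.compress g"] h.pr_W'[OF z(1)]
          by (simp add: h.compress_def)
        moreover have "b (g z) x = 0" using h.alt_image_orthogonal nilspaceD(2)[OF N gV(1)] gV(2) by blast
        ultimately have "g z = b (g z) y *s x" by (simp add: h.pr_orthogonal)
        then have "g (z - a *s x) = b (g z) y *s x"
          using linear_diff[OF nilspaceD(4)[OF N gV(1)]] linear_scale[OF nilspaceD(4)[OF N gV(1)]] gV(2)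
          by simp
        then show ?thesis by blast
      qed
      show "\<exists>c\<in>W. b x c = 0 \<and> (\<lambda>p. wedge (z - a *s x) w p + wedge x c p) \<in> V"
        if "w \<in> W" "b x w = 0" "b (z - a *s x) w = 0" for w
        using h.lift_wedge[OF V z that] .
    qed
    then show ?thesis ..
  qed
qed

end

section \<open>Flags\<close>

context hyperbolic_pair
begin

lemma span_insert_iff:
  assumes "subspace F"
  shows "z \<in> span (insert x F) \<longleftrightarrow> (\<exists>c. z - c *s x \<in> F)"
proof -
  have "span F = F" using assms by simp
  then show ?thesis unfolding span_breakdown_eq by (simp only:)
qed

text \<open>On \<open>x^\<bottom>\<close> the map \<open>u\<close> and its compression differ by
  multiples of \<open>x\<close>, which the enlarged subspace absorbs.\<close>

lemma compress_mem_iff: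
  assumes u: "u \<in> alt W" "u x = 0" and F: "subspace F" "F \<subseteq> W'"
  shows "u ` span (insert x F) \<subseteq> span (insert x F) \<longleftrightarrow> compress u ` F \<subseteq> F"
proof
  assume *: "u ` span (insert x F) \<subseteq> span (insert x F)"
  show "compress u ` F \<subseteq> F"
  proof
    fix w assume "w \<in> compress u ` F"
    then obtain f where f: "f \<in> F" "w = compress u f" by blast
    then have "u f \<in> span (insert x F)" using * span_base[of f "insert x F"] by blast
    then obtain c where c: "u f - c *s x \<in> F" using span_insert_iff[OF F(1)] by blast
    have "w = pr (u f)" using f F(2) pr_W' by (auto simp: compress_def)
    also have "\<dots> = pr (u f - c *s x)" by (simp add: linear_simps[OF lin_pr])
    also have "\<dots> = u f - c *s x" using c F(2) pr_W' by blast
    finally show "w \<in> F" using c by simp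
  qed
next
  assume *: "compress u ` F \<subseteq> F"
  show "u ` span (insert x F) \<subseteq> span (insert x F)"
  proof
    fix w assume "w \<in> u ` span (insert x F)"
    then obtain z where z: "z \<in> span (insert x F)" "w = u z" by blast
    then obtain c where c: "z - c *s x \<in> F" using span_insert_iff[OF F(1)] by blast
    then have "compress u (z - c *s x) \<in> F" using * by blast
    moreover have "compress u (z - c *s x) = pr (u (z - c *s x))"
      using c F(2) pr_W' by (simp add: compress_def subset_iff)
    moreover have "u (z - c *s x) = w" using z(2) u(2) by (simp add: alt_linear[OF u(1)])
    ultimately have "pr w \<in> F" by simp
    then have "w - b w y *s x \<in> F"
      using pr_orthogonal alt_image_orthogonal[OF u] z(2) by simp
    then show "w \<in> span (insert x F)" using span_insert_iff[OF F(1)] by blast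
  qed
qed

end

context quadratic_space
begin

text \<open>The flag is \<open>{0}\<close> followed by the flag of the quotient with
  \<open>x\<close> adjoined to each member, for an isotropic \<open>x\<close> killed by
  \<open>V\<close>.\<close>

theorem maxnil_flag:
  assumes "maxnil W k V" "k > 1 \<Longrightarrow> \<exists>t::'a. t \<noteq> 0 \<and> t \<noteq> 1 \<and> t \<noteq> -1"
  shows "\<exists>Fs. length Fs = Suc k \<and> (\<forall>F\<in>set Fs. F \<subseteq> W \<and> totally_singular scale b F) \<and>
    sorted_wrt (\<subseteq>) Fs \<and> partially_complete scale Fs \<and>
    V = {u \<in> alt W. nilpotent_endo u \<and> stabilizes_flag u Fs}"
  using assms
proof (induction k arbitrary: W V)
  case 0
  note M = maxnilD[OF 0(1)]
  have V0: "(\<lambda>x. 0) \<in> V" using fs_subspace_0 nilspaceD(1)[OF M(3)] by blast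
  have "V = {u \<in> alt W. nilpotent_endo u \<and> stabilizes_flag u [{0}]}"
    using nilspaceD(2,3)[OF M(3)] witt_0_nilpotent[OF M(2,5)] V0 alt_linear(4)
    by (auto simp: stabilizes_flag_def)
  moreover have "{0} \<subseteq> W" using subspace_0[OF M(5)] by simp
  moreover have "totally_singular scale b {0}" by (simp add: totally_singular_def)
  moreover have "partially_complete scale [{0}]" by (simp add: partially_complete_def)
  ultimately show ?case by (intro exI[of _ "[{0}]"]) simp
next
  case (Suc k)
  note M = maxnilD[OF Suc.prems(1)]
  obtain x where x: "x \<in> W" "x \<noteq> 0" "b x x = 0" and Vx: "\<And>v. v \<in> V \<Longrightarrow> v x = 0"
    using maxnil_common_kernel[OF Suc.prems(1)] Suc.prems(2) by auto
  obtain y where "hyperbolic_pair scale Basis b W x y"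
    using hyperbolic_pairI[OF M(1) x(1,3,2)] by blast
  then interpret h: hyperbolic_pair scale Basis b W x y .
  obtain Gs where Gs: "length Gs = Suc k" "\<And>G. G \<in> set Gs \<Longrightarrow> G \<subseteq> h.W'"
    "\<And>G. G \<in> set Gs \<Longrightarrow> totally_singular scale b G" "sorted_wrt (\<subseteq>) Gs"
    "partially_complete scale Gs"
    "h.quot V = {u \<in> alt h.W'. nilpotent_endo u \<and> stabilizes_flag u Gs}"
    using Suc.IH[OF h.maxnil_quot[OF Suc.prems(1)]] Suc.prems(2) by auto
  have sG: "subspace G" if "G \<in> set Gs" for G using Gs(3)[OF that] by (simp add: totally_singular_def)
  let ?e = "\<lambda>G. span (insert x G)"
  let ?Fs = "{0} # map ?e Gs"
  have sub: "F \<subseteq> W" "totally_singular scale b F" if F: "F \<in> set ?Fs" for F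
  proof -
    consider "F = {0}" | G where "G \<in> set Gs" "F = ?e G" using F by auto
    then have "F \<subseteq> W \<and> totally_singular scale b F"
    proof cases
      case 1
      then show ?thesis using subspace_0[OF M(5)] by (simp add: totally_singular_def)
    next
      case 2
      have "G \<subseteq> W" using Gs(2)[OF 2(1)] by (auto simp: h.W'_iff)
      then have "F \<subseteq> W" unfolding 2(2) using x(1) M(5) by (intro span_minimal) auto
      moreover have "totally_singular scale b F"
        unfolding 2(2) using Gs(3)[OF 2(1)]
        by (rule h.totally_singular_insert) (use Gs(2)[OF 2(1)] h.W'_iff in blast)
      ultimately show ?thesis ..
    qed
    then show "F \<subseteq> W" "totally_singular scale b F" by auto
  qed
  have sorted: "sorted_wrt (\<subseteq>) ?Fs"
  proof -
    have "sorted_wrt (\<lambda>F G. ?e F \<subseteq> ?e G) Gs"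
      by (rule sorted_wrt_mono_rel[OF _ Gs(4)]) (intro span_mono insert_mono)
    then show ?thesis using span_zero by (simp add: sorted_wrt_map)
  qed
  have dimF: "dim (?e G) = Suc (dim G)" if "G \<in> set Gs" for G
  proof -
    have "x \<notin> G" using Gs(2)[OF that] h.byx by (auto simp: h.W'_iff)
    then have "x \<notin> span G" using sG[OF that] by (metis span_eq_iff)
    then show ?thesis by (simp add: dim_insert)
  qed
  have pc: "partially_complete scale ?Fs"
    unfolding partially_complete_def
  proof (intro allI impI)
    fix i assume i: "i < length ?Fs"
    show "dim (?Fs ! i) = i"
    proof (cases i)
      case (Suc j)
      then have "j < length Gs" using i by simp
      then show ?thesis using Suc dimF[OF nth_mem] Gs(5) by (simp add: partially_complete_def)
    qed simp
  qed
  \<comment> \<open>This makes the line of \<open>x\<close> a member of the new flag; a nilpotent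
    map stabilizing that line kills \<open>x\<close>.\<close>
  have G0: "{0} \<in> set Gs"
  proof -
    have "dim (Gs ! 0) = 0" using Gs(1,5) by (simp add: partially_complete_def)
    moreover have g0: "Gs ! 0 \<in> set Gs" using Gs(1) by simp
    ultimately have "Gs ! 0 \<subseteq> {0}" by (metis dim_eq_0)
    then have "Gs ! 0 = {0}" using subspace_0[OF sG[OF g0]] by blast
    then show ?thesis using g0 by simp
  qed
  have stab_iff: "stabilizes_flag u ?Fs \<longleftrightarrow> stabilizes_flag (h.compress u) Gs"
    if "u \<in> alt W" "u x = 0" for u
    using h.compress_mem_iff[OF that sG Gs(2)] alt_linear(4)[OF that(1)]
    by (simp add: stabilizes_flag_def)
  have "V = {u \<in> alt W. nilpotent_endo u \<and> stabilizes_flag u ?Fs}"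
  proof (intro set_eqI iffI)
    fix v assume v: "v \<in> V"
    have va: "v \<in> alt W" "nilpotent_endo v" using nilspaceD(2,3)[OF M(3) v] .
    have "h.compress v \<in> h.quot V" using v Vx by (simp add: h.quot_def stab_def)
    then have "stabilizes_flag v ?Fs" using stab_iff[OF va(1) Vx[OF v]] Gs(6) by simp
    then show "v \<in> {u \<in> alt W. nilpotent_endo u \<and> stabilizes_flag u ?Fs}" using va by simp
  next
    fix u assume "u \<in> {u \<in> alt W. nilpotent_endo u \<and> stabilizes_flag u ?Fs}"
    then have u: "u \<in> alt W" "nilpotent_endo u" "stabilizes_flag u ?Fs" by auto
    have "u x \<in> ?e {0}"
      using u(3) G0 span_base[of x "insert x {0}"] by (auto simp: stabilizes_flag_def)
    then obtain c where c: "u x = c *s x" by (auto simp: insert_commute span_singleton)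
    then have ux: "u x = 0" using nilpotent_endo_eigen[OF u(2) alt_lin[OF u(1)] c] x(2) by fastforce
    have "h.compress u \<in> h.quot V"
      unfolding Gs(6) using h.compress_in_alt[OF u(1)] h.compress_nilpotent[OF u(1) ux u(2)]
        stab_iff[OF u(1) ux] u(3) by simp
    then obtain v where v: "v \<in> V" "v x = 0" "h.compress u = h.compress v" by (rule h.quotE)
    let ?h = "\<lambda>z. u z - v z"
    have "?h \<in> alt W" using alt_diff[OF M(5) u(1) nilspaceD(2)[OF M(3) v(1)]] .
    then obtain c where c: "c \<in> W" "b x c = 0" "?h = wedge x c"
      using h.compress_eq_0[of ?h] v(2,3) ux by (auto simp: h.compress_diff)
    \<comment> \<open>Since \<open>V\<close> kills \<open>x\<close>, orthogonality to
      \<open>x\<close> is the only condition on \<open>c\<close>.\<close>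
    have "c \<in> annih W V x" unfolding annih_iff using c(1,2) Vx b_simps(7) by metis
    then have "wedge x c \<in> V" by (rule h.maxnil_wedge[OF Suc.prems(1)])
    then have "(\<lambda>z. v z + wedge x c z) \<in> V"
      by (rule fs_subspace_add[OF nilspaceD(1)[OF M(3)] v(1)])
    then show "u \<in> V" by (simp add: c(3)[symmetric])
  qed
  then show ?case
    using sub sorted pc Gs(1) by (intro exI[of _ ?Fs]) auto
qed

section \<open>Passage to the whole space and to the stated notions\<close>

lemma alternating_endos_eq_alt: "alternating_endos scale b = alt UNIV"
  using linear_b_comp(1) linear_b_left
  by (auto simp: alternating_endos_def alternating_form_def bilinear_form_def alt_def)

lemma witt_witt_index: "witt UNIV (witt_index scale b)"
proof -
  let ?D = "dim ` {X. totally_singular scale b X}"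
  have fin: "finite ?D"
    by (rule finite_subset[of _ "{..dimension}"]) (auto simp: dim_subset_UNIV)
  have "totally_singular scale b {0}" by (simp add: totally_singular_def)
  then have "?D \<noteq> {}" by blast
  then have "Max ?D \<in> ?D" by (rule Max_in[OF fin])
  moreover have "dim X \<le> Max ?D" if "totally_singular scale b X" for X
    using fin that by (intro Max_ge) auto
  ultimately show ?thesis unfolding witt_def witt_index_def by auto
qed

text \<open>A totally singular subspace lies in its own orthogonal complement.\<close>

lemma witt_double_le:
  assumes "regular W" "witt W k"
  shows "2 * k \<le> dim W"
proof -
  obtain X where X: "X \<subseteq> W" "totally_singular scale b X" "dim X = k"
    using assms(2) by (auto simp: witt_def)
  then have "X \<subseteq> W \<inter> perp X" by (auto simp: totally_singular_def perp_def)
  then have "k \<le> dim (W \<inter> perp X)" using dim_subset X(3) by blast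
  then show ?thesis
    using dim_perp[OF assms(1) _ X(1)] X(2,3) by (simp add: totally_singular_def)
qed

end

lemma CHAR_neq_2_imp_two_neq_0:
  assumes "CHAR('a::field) \<noteq> 2"
  shows "(2::'a) \<noteq> 0"
proof
  assume "(2::'a) = 0"
  then have "of_nat 2 = (0::'a)" by simp
  then have d: "CHAR('a) dvd 2" by (simp only: of_nat_eq_0_iff_char_dvd)
  have "CHAR('a) \<noteq> 0"
  proof
    assume z: "CHAR('a) = 0"
    show False using d unfolding z by simp
  qed
  moreover have "CHAR('a) \<le> 2" using d by (rule dvd_imp_le) simp
  ultimately have "CHAR('a) = 1" using assms by linarith
  then show False using of_nat_CHAR[where ?'a = 'a] by simp
qed

theorem theorem1p5:
  fixes scale :: "'a::field \<Rightarrow> 'b::ab_group_add \<Rightarrow> 'b"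
    and Basis :: "'b set"
    and b :: "'b \<Rightarrow> 'b \<Rightarrow> 'a"
    and n \<nu> :: nat
    and \<V> :: "('b \<Rightarrow> 'b) set"
  assumes "CHAR('a) \<noteq> 2"
    and "finite_dimensional_vector_space scale Basis"
    and "vector_space.dim scale (UNIV :: 'b set) = n"
    and "bilinear_form scale b"
    and "symmetric_form b"
    and "nondegenerate_form b"
    and "witt_index scale b = \<nu>"
    and "module.subspace (fun_scale scale) \<V>"
    and "\<V> \<subseteq> alternating_endos scale b"
    and "\<forall>u\<in>\<V>. nilpotent_endo u"
    and "infinite (UNIV :: 'a set) \<or> card (UNIV :: 'a set) \<ge> min n (2 * \<nu> + 1)"
    and "int (vector_space.dim (fun_scale scale) \<V>) = int \<nu> * (int n - int \<nu> - 1)"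
  shows "\<exists>Fs. maximal_pc_singular_flag scale b Fs \<and> \<V> = NA scale b Fs"
proof -
  interpret fd: finite_dimensional_vector_space scale Basis by fact
  interpret quadratic_space scale Basis b
    using assms(4,5) CHAR_neq_2_imp_two_neq_0[OF assms(1)]
    by unfold_locales (auto simp: symmetric_form_def)
  have reg: "regular UNIV" using assms(6) by (auto simp: regular_def nondegenerate_form_def)
  have w: "witt UNIV \<nu>" using witt_witt_index assms(7) by simp
  have "maxnil UNIV \<nu> \<V>"
    using reg w assms(3,8,9,10,12)
    by (simp add: maxnil_def nilspace_def bound_def alternating_endos_eq_alt)
  \<comment> \<open>For \<open>\<nu> \<ge> 2\<close> both \<open>n \<ge> 2 * \<nu>\<close> and
    \<open>2 * \<nu> + 1\<close> are at least four, so the field has more elements than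
    \<open>0\<close>, \<open>1\<close> and \<open>-1\<close>.\<close>
  moreover have "\<exists>t::'a. t \<noteq> 0 \<and> t \<noteq> 1 \<and> t \<noteq> -1" if "\<nu> > 1"
  proof (rule ccontr)
    assume "\<not> ?thesis"
    then have *: "(UNIV :: 'a set) \<subseteq> {0, 1, -1}" by blast
    then have "card (UNIV :: 'a set) \<le> card {0, 1, -1 :: 'a}" by (intro card_mono) auto
    also have "\<dots> \<le> 3" by (simp add: card_insert_if)
    finally have "min n (2 * \<nu> + 1) \<le> 3"
      using assms(11) finite_subset[OF *] by auto
    then show False using witt_double_le[OF reg w] assms(3) that by simp
  qed
  ultimately obtain Fs where Fs: "length Fs = Suc \<nu>" "\<And>F. F \<in> set Fs \<Longrightarrow> totally_singular scale b F"
    "sorted_wrt (\<subseteq>) Fs" "partially_complete scale Fs"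
    "\<V> = {u \<in> alt UNIV. nilpotent_endo u \<and> stabilizes_flag u Fs}"
    using maxnil_flag[of UNIV \<nu> \<V>] by blast
  have "Fs \<noteq> []" using Fs(1) by auto
  then have "maximal_pc_singular_flag scale b Fs"
    using Fs assms(7) Fs(2)[OF last_in_set]
    by (auto simp: maximal_pc_singular_flag_def flag_def singular_flag_def)
      (auto simp: totally_singular_def)
  moreover have "\<V> = NA scale b Fs"
    using Fs(5) by (simp add: NA_def alternating_endos_eq_alt)
  ultimately show ?thesis by blast
qed

end
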